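(* Let $n>0$, $x>0$, $\delta\in\mathbb R$ and $y=x^2/(n+x^2)$, so $0<y<1$. Then $$P_n(x;\delta)=\tfrac12e^{-\frac12\delta^2}\frac{\sqrt{y}\,(1-y)^{\frac12n}}{2\pi i}\int_0^{(1+)}e^{\frac12\delta^2 y\tau}\,\frac{\tau^{\frac12n-\frac12}}{(\tau-1)^{\frac12n}(1-y\tau)}\,d\tau,$$ $$Q_n(x;\delta)=\tfrac12e^{-\frac12\delta^2}\frac{\sqrt{y}\,(1-y)^{\frac12n}}{2\pi i}\int_0^{(1+)}e^{\frac12\delta^2 y\tau}\,\frac{\tau^{\frac12n-\frac12}\operatorname{erf}\left(\delta\sqrt{\frac12 y\tau}\right)}{(\tau-1)^{\frac12n}(1-y\tau)}\,d\tau,$$ $$R_n(x;\delta)=\tfrac12\operatorname{erfc}\left(\delta/\sqrt2\right)-\tfrac12e^{-\frac12\delta^2}\frac{\sqrt{y}\,(1-y)^{\frac12n}}{2\pi i}\int_0^{(1+)}e^{\frac12\delta^2 y\tau}\,\frac{\tau^{\frac12n-\frac12}\operatorname{erfc}\left(\delta\sqrt{\frac12 y\tau}\right)}{(\tau-1)^{\frac12n}(1-y\tau)}\,d\tau .$$ Here the contour $\int_0^{(1+)}$ is a finite contour that starts at the origin, encircles the point $\tau=1$ once anti-clockwise, and returns to the origin; the pole $\tau=1/y$ lies outside the contour, i.e. the contour cuts the positive real axis between $1$ and $1/y$. The multivalued factors assume their principal values, with $\tau-1$ positive for $\tau>1$.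
   Context: Notation. $\operatorname{erfc}(z)=\frac{2}{\sqrt\pi}\int_z^\infty e^{-t^2}dt$, $\operatorname{erf}=1-\operatorname{erfc}$ (both entire functions). $I_y(a,b)=\frac{1}{B(a,b)}\int_0^y t^{a-1}(1-t)^{b-1}dt$ is the normalized incomplete beta function, with $B(a,b)=\Gamma(a)\Gamma(b)/\Gamma(a+b)$. For $x\ge 0$, $\delta\in\mathbb R$, $n>0$ (not necessarily an integer), with $y=x^2/(n+x^2)$, define $$P_n(x;\delta)=\tfrac12 e^{-\frac12\delta^2}\sum_{j=0}^\infty \frac{(\frac12\delta^2)^j}{j!}\, I_y\left(j+\tfrac12,\tfrac12 n\right),\qquad Q_n(x;\delta)=\tfrac12 e^{-\frac12\delta^2}\sum_{j=0}^\infty \frac{\delta}{\sqrt2}\frac{(\frac12\delta^2)^j}{\Gamma(j+\frac32)}\, I_y\left(j+1,\tfrac12 n\right),$$ and $R_n(x;\delta)=\tfrac12\operatorname{erfc}(\delta/\sqrt2)+Q_n(x;\delta)-P_n(x;\delta)$. The contour, apart from its two endpoints at $0$, stays off the branch cut $(-\infty,1]$ of the principal branches; it leaves the origin in the lower half-plane and returns to it from the upper half-plane. *)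

theory Defs
  imports "HOL-Complex_Analysis.Complex_Analysis"
begin

text \<open>
  The integral from \<open>z\<close> to \<open>\<infinity>\<close> is taken along the horizontal ray
  \<open>t = z + s\<close>, \<open>s \<ge> 0\<close>. The definition is used both on the reals and on the
  complex numbers.
\<close>

definition erfc :: "'a \<Rightarrow> 'a :: {real_normed_field, banach}" where
  "erfc z = 2 / of_real (sqrt pi) * integral {0..} (\<lambda>s. exp (- ((z + of_real s)\<^sup>2)))"

definition erf :: "'a \<Rightarrow> 'a :: {real_normed_field, banach}" where
  "erf z = 1 - erfc z"

definition inc_beta :: "real \<Rightarrow> real \<Rightarrow> real \<Rightarrow> real" where
  "inc_beta y a b =
     1 / Beta a b * integral {0..y} (\<lambda>t. t powr (a - 1) * (1 - t) powr (b - 1))"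

definition P_nct :: "real \<Rightarrow> real \<Rightarrow> real \<Rightarrow> real" where
  "P_nct n x \<delta> = (let y = x\<^sup>2 / (n + x\<^sup>2) in
     1 / 2 * exp (- (\<delta>\<^sup>2 / 2)) *
     (\<Sum>j. (\<delta>\<^sup>2 / 2) ^ j / fact j * inc_beta y (real j + 1 / 2) (n / 2)))"

definition Q_nct :: "real \<Rightarrow> real \<Rightarrow> real \<Rightarrow> real" where
  "Q_nct n x \<delta> = (let y = x\<^sup>2 / (n + x\<^sup>2) in
     1 / 2 * exp (- (\<delta>\<^sup>2 / 2)) *
     (\<Sum>j. \<delta> / sqrt 2 * ((\<delta>\<^sup>2 / 2) ^ j / Gamma (real j + 3 / 2)) *
          inc_beta y (real j + 1) (n / 2)))"

definition R_nct :: "real \<Rightarrow> real \<Rightarrow> real \<Rightarrow> real" where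
  "R_nct n x \<delta> = 1 / 2 * erfc (\<delta> / sqrt 2) + Q_nct n x \<delta> - P_nct n x \<delta>"

text \<open>
  The contours \<open>0 \<rightarrow> (1+) \<rightarrow> 0\<close> with the pole \<open>1/y\<close> outside. Encircling \<open>1\<close> once
  anti-clockwise and leaving \<open>1/y\<close> outside are expressed by winding numbers, so
  the loop need not be simple; a simple loop of this kind that crosses the
  positive real axis once does so between \<open>1\<close> and \<open>1/y\<close>.
\<close>

definition loop_around_1 :: "real \<Rightarrow> (real \<Rightarrow> complex) \<Rightarrow> bool" where
  "loop_around_1 y \<gamma> \<longleftrightarrow>
     valid_path \<gamma> \<and> pathstart \<gamma> = 0 \<and> pathfinish \<gamma> = 0 \<and>
     (\<forall>t\<in>{0<..<1}. \<gamma> t \<notin> complex_of_real ` {..1}) \<and>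
     (\<forall>\<^sub>F t in at_right 0. Im (\<gamma> t) < 0) \<and>
     (\<forall>\<^sub>F t in at_left 1. Im (\<gamma> t) > 0) \<and>
     winding_number \<gamma> 1 = 1 \<and>
     complex_of_real (1 / y) \<notin> path_image \<gamma> \<and>
     winding_number \<gamma> (complex_of_real (1 / y)) = 0"

text \<open>
  The integrand without its error function factor. The complex \<open>powr\<close> is the
  principal branch; the junk value at \<open>\<tau> = 0\<close> concerns only the endpoints.
\<close>

definition kern :: "real \<Rightarrow> real \<Rightarrow> real \<Rightarrow> complex \<Rightarrow> complex" where
  "kern n y \<delta> \<tau> =
     exp (of_real (\<delta>\<^sup>2 / 2 * y) * \<tau>) *
     (\<tau> powr of_real (n / 2 - 1 / 2) /
       ((\<tau> - 1) powr of_real (n / 2) * (1 - of_real y * \<tau>)))"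

definition prefactor :: "real \<Rightarrow> real \<Rightarrow> real \<Rightarrow> complex" where
  "prefactor n y \<delta> =
     of_real (1 / 2 * exp (- (\<delta>\<^sup>2 / 2))) *
     (of_real (sqrt y * (1 - y) powr (n / 2)) / (2 * of_real pi * \<i>))"

end

theory Submission
  imports Defs "HOL-Real_Asymp.Real_Asymp" "HOL-Probability.Distributions"
begin

text \<open>
  Expanding \<open>1 / (1 - y \<tau>)\<close> and the entire factor of the integrand into powers of \<open>\<tau>\<close>
  reduces everything to Pochhammer's loop integral
  \<open>\<integral> \<tau>\<^bsup>s-1\<^esup> (\<tau> - 1)\<^bsup>-q\<^esup> d\<tau> = 2\<pi>\<i> \<Gamma>(s) / (\<Gamma>(s-q+1) \<Gamma>(q))\<close>, because
  \<open>I\<^sub>y(p,q) = y\<^sup>p (1-y)\<^sup>q \<Sum>\<^sub>k \<Gamma>(p+q+k) / (\<Gamma>(p+k+1) \<Gamma>(q)) y\<^sup>k\<close>.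

  A loop integral of a function holomorphic on the plane slit along \<open>(-\<infinity>,1]\<close> is the difference of
  the limits at \<open>0\<close> of a primitive, taken from the upper and from the lower half-plane, hence does
  not depend on the loop; the pole at \<open>1/y\<close> contributes nothing since its winding number
  vanishes. Pochhammer's integral is evaluated for \<open>0 < q \<le> 1\<close> and \<open>s > 1\<close> on the circle
  \<open>\<bar>\<tau> - 1\<bar> = 1\<close> by the binomial series, and for other parameters by recurrences that express
  that the integral of a derivative is zero. The series are integrated termwise on circles through
  \<open>0\<close> that cross the real axis between \<open>1\<close> and \<open>1/y\<close>. For \<open>Q\<close> one uses
  \<open>exp(z\<^sup>2) erf z = \<Sum>\<^sub>j z\<^bsup>2j+1\<^esup> / \<Gamma>(j+3/2)\<close>.
\<close>


section \<open>Integrals along loops in the slit plane\<close>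

text \<open>The cut of \<open>z powr a\<close> lies inside the cut of \<open>(z - 1) powr b\<close>,
  so both principal branches are holomorphic here.\<close>

definition slit_plane :: "complex set" where
  "slit_plane = - complex_of_real ` {..1}"

text \<open>Departure below the cut and return above it select the two one-sided limits of a
  primitive at \<open>0\<close>, and these fix the integral.\<close>

definition slit_loop :: "(real \<Rightarrow> complex) \<Rightarrow> bool" where
  "slit_loop \<gamma> \<longleftrightarrow> valid_path \<gamma> \<and> pathstart \<gamma> = 0 \<and> pathfinish \<gamma> = 0 \<and>
     (\<forall>t\<in>{0<..<1}. \<gamma> t \<in> slit_plane) \<and>
     (\<forall>\<^sub>F t in at_right 0. Im (\<gamma> t) < 0) \<and> (\<forall>\<^sub>F t in at_left 1. Im (\<gamma> t) > 0)"

lemma slit_plane_iff: "z \<in> slit_plane \<longleftrightarrow> Im z \<noteq> 0 \<or> Re z > 1"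
proof -
  have "z \<in> complex_of_real ` {..1} \<longleftrightarrow> Im z = 0 \<and> Re z \<le> 1"
    by (auto simp: image_iff complex_eq_iff intro!: bexI[of _ "Re z"])
  then show ?thesis by (auto simp: slit_plane_def)
qed

lemma nonpos_Reals_slit_plane:
  assumes "z \<in> slit_plane"
  shows "z \<notin> \<real>\<^sub>\<le>\<^sub>0" "z - 1 \<notin> \<real>\<^sub>\<le>\<^sub>0" "z \<noteq> 0" "z \<noteq> 1"
  using assms by (auto simp: slit_plane_iff complex_nonpos_Reals_iff)

lemma open_slit_plane: "open slit_plane"
proof -
  have "slit_plane = {z. Im z < 0} \<union> {z. Im z > 0} \<union> {z. Re z > 1}"
    by (auto simp: slit_plane_iff)
  then show ?thesis
    by (metis open_Un open_halfspace_Im_lt open_halfspace_Im_gt open_halfspace_Re_gt)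
qed

text \<open>The centre is \<open>2\<close>: the segment to a non-real point meets the real axis only
  in \<open>2\<close>, and the segment to a real point beyond \<open>1\<close> stays beyond
  \<open>1\<close>. Starlikeness yields global primitives.\<close>

lemma starlike_slit_plane: "starlike slit_plane"
  unfolding starlike_def
proof (intro bexI[of _ 2] ballI subsetI)
  fix z w assume z: "z \<in> slit_plane" and "w \<in> closed_segment 2 z"
  then obtain u where u: "0 \<le> u" "u \<le> 1" "w = (1 - u) *\<^sub>R 2 + u *\<^sub>R z"
    by (auto simp: closed_segment_def)
  show "w \<in> slit_plane"
  proof (cases "u = 0 \<or> Im z \<noteq> 0")
    case True then show ?thesis using u by (auto simp: slit_plane_iff)
  next
    case False
    then have "Re z > 1" using z by (auto simp: slit_plane_iff)
    then have "u * (Re z - 1) > 0" using False u by auto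
    moreover have "Re w = 1 + (1 - u) + u * (Re z - 1)" unfolding u(3) by (simp add: algebra_simps)
    ultimately have "Re w > 1" using u by linarith
    then show ?thesis by (simp add: slit_plane_iff)
  qed
qed (simp add: slit_plane_iff)

lemma slit_plane_primitive:
  assumes "g holomorphic_on slit_plane"
  obtains G where "\<And>z. z \<in> slit_plane \<Longrightarrow> (G has_field_derivative g z) (at z)"
proof -
  have "\<exists>G. \<forall>x\<in>slit_plane. (G has_field_derivative g x) (at x)"
    by (rule holomorphic_starlike_primitive[where k = "{}"])
      (use assms open_slit_plane starlike_slit_plane in
        \<open>auto simp: holomorphic_on_imp_continuous_on holomorphic_on_imp_differentiable_at\<close>)
  then show ?thesis using that by blast
qed

text \<open>
  The integral exists in the Henstock--Kurzweil sense for every such loop, although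
  \<open>norm (g (\<gamma> t) * \<gamma>' t)\<close> need not be integrable near the endpoints.
\<close>

lemma slit_loop_integral_primitive:
  assumes \<gamma>: "slit_loop \<gamma>"
    and G: "\<And>z. z \<in> slit_plane \<Longrightarrow> (G has_field_derivative g z) (at z)"
    and lower: "(G \<longlongrightarrow> l) (at 0 within {z. Im z < 0})"
    and upper: "(G \<longlongrightarrow> u) (at 0 within {z. Im z > 0})"
  shows "(g has_contour_integral (u - l)) \<gamma>"
proof -
  \<comment> \<open>\<open>H\<close> follows \<open>G\<close> along the loop but takes the limits
    \<open>l\<close> and \<open>u\<close> at the endpoints, where \<open>G 0\<close> itself is
    arbitrary. It is continuous on the closed interval, so the fundamental theorem applies with
    exceptional set \<open>S\<close>.\<close>
  define H where "H = (\<lambda>t. if t = 0 then l else if t = 1 then u else G (\<gamma> t))"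
  from \<gamma> have vp: "valid_path \<gamma>" and st: "\<gamma> 0 = 0" "\<gamma> 1 = 0"
    and D: "\<And>t. 0 < t \<Longrightarrow> t < 1 \<Longrightarrow> \<gamma> t \<in> slit_plane"
    and lo: "\<forall>\<^sub>F t in at_right 0. Im (\<gamma> t) < 0" and up: "\<forall>\<^sub>F t in at_left 1. Im (\<gamma> t) > 0"
    by (auto simp: slit_loop_def pathstart_def pathfinish_def)
  from vp obtain S where S: "finite S" "\<gamma> C1_differentiable_on {0..1} - S" and cont: "continuous_on {0..1} \<gamma>"
    by (auto simp: valid_path_def piecewise_C1_differentiable_on_def)
  have c0: "(\<gamma> \<longlongrightarrow> 0) (at_right 0)"
    using cont st by (metis at_within_Icc_at_right atLeastAtMost_iff continuous_on_def order_refl zero_le_one zero_less_one)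
  have c1: "(\<gamma> \<longlongrightarrow> 0) (at_left 1)"
    using cont st by (metis at_within_Icc_at_left atLeastAtMost_iff continuous_on_def order_refl zero_le_one zero_less_one)
  have "filterlim \<gamma> (at 0 within {z. Im z < 0}) (at_right 0)"
    using c0 lo by (auto simp: filterlim_at elim: eventually_mono)
  with lower have H0: "((\<lambda>t. G (\<gamma> t)) \<longlongrightarrow> l) (at_right 0)"
    by (rule filterlim_compose)
  have "filterlim \<gamma> (at 0 within {z. Im z > 0}) (at_left 1)"
    using c1 up by (auto simp: filterlim_at elim: eventually_mono)
  with upper have H1: "((\<lambda>t. G (\<gamma> t)) \<longlongrightarrow> u) (at_left 1)"
    by (rule filterlim_compose)
  have deriv: "(H has_vector_derivative g (\<gamma> t) * vector_derivative \<gamma> (at t)) (at t)"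
    if t: "t \<in> {0<..<1} - S" for t
  proof -
    have "(\<gamma> has_vector_derivative vector_derivative \<gamma> (at t)) (at t)"
      using S(2) t by (auto simp: C1_differentiable_on_eq vector_derivative_works)
    then have "((G \<circ> \<gamma>) has_vector_derivative vector_derivative \<gamma> (at t) * g (\<gamma> t)) (at t)"
      by (rule field_vector_diff_chain_at) (use t D G in auto)
    then have "(H has_vector_derivative vector_derivative \<gamma> (at t) * g (\<gamma> t)) (at t)"
      by (rule has_vector_derivative_transform_within_open[where S = "{0<..<1}"])
        (use t in \<open>auto simp: H_def\<close>)
    then show ?thesis by (simp add: mult.commute)
  qed
  have "continuous_on {0..1} H"
    unfolding continuous_on_def
  proof
    fix t :: real assume t: "t \<in> {0..1}"
    consider "t = 0" | "t = 1" | "0 < t" "t < 1" using t by fastforce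
    then show "(H \<longlongrightarrow> H t) (at t within {0..1})"
    proof cases
      case 1
      have "\<forall>\<^sub>F t in at_right 0. G (\<gamma> t) = H t"
        using eventually_at_right_real[of 0 1] by (auto simp: H_def elim!: eventually_mono)
      then show ?thesis using 1 H0 by (simp add: at_within_Icc_at_right H_def tendsto_cong)
    next
      case 2
      have "\<forall>\<^sub>F t in at_left 1. G (\<gamma> t) = H t"
        using eventually_at_left_real[of 0 1] by (auto simp: H_def elim!: eventually_mono)
      then show ?thesis using 2 H1 by (simp add: at_within_Icc_at_left H_def tendsto_cong)
    next
      case 3
      have "isCont G (\<gamma> t)" using 3 D G DERIV_isCont by blast
      moreover have "isCont \<gamma> t" using 3 cont by (simp add: continuous_on_interior)
      ultimately have "((\<lambda>t. G (\<gamma> t)) \<longlongrightarrow> G (\<gamma> t)) (at t)"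
        using isCont_o2 isContD by blast
      moreover have "\<forall>\<^sub>F s in at t. G (\<gamma> s) = H s"
        using 3 eventually_at_in_open'[of "{0<..<1}" t] by (auto simp: H_def elim!: eventually_mono)
      ultimately have "(H \<longlongrightarrow> H t) (at t)" using 3 by (simp add: H_def tendsto_cong)
      then show ?thesis by (rule tendsto_within_subset) simp
    qed
  qed
  then have "((\<lambda>t. g (\<gamma> t) * vector_derivative \<gamma> (at t)) has_integral H 1 - H 0) {0..1}"
    using fundamental_theorem_of_calculus_interior_strong[OF S(1) _ deriv] by simp
  then show ?thesis by (simp add: has_contour_integral H_def)
qed

text \<open>
  The substitution \<open>z = w\<^sup>2\<close> absorbs the singularity: \<open>G (w\<^sup>2)\<close> has the bounded derivative
  \<open>2 w g (w\<^sup>2)\<close>, so it is Lipschitz on a convex set.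
\<close>

lemma primitive_tendsto_at_0:
  assumes G: "\<And>z. z \<in> T \<Longrightarrow> (G has_field_derivative g z) (at z)"
    and bnd: "\<And>z. z \<in> T \<Longrightarrow> norm z < r \<Longrightarrow> norm (g z) * sqrt (norm z) \<le> C"
    and W: "convex W" "\<And>w. w \<in> W \<Longrightarrow> w\<^sup>2 \<in> T" "\<And>z. z \<in> T \<Longrightarrow> csqrt z \<in> W" and "r > 0" "0 \<notin> T"
  obtains l where "(G \<longlongrightarrow> l) (at 0 within T)"
proof (cases "at 0 within T = bot")
  case True
  then show ?thesis using that[of 0] by simp
next
  case False
  define X where "X = W \<inter> ball 0 (sqrt r)"
  have "convex X" unfolding X_def using W(1) by (simp add: convex_Int)
  have d: "((\<lambda>w. G (w\<^sup>2)) has_field_derivative g (w\<^sup>2) * (2 * w)) (at w within X)" if "w \<in> X" for w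
    using G[of "w\<^sup>2"] W(2) that unfolding X_def
    by (auto intro!: derivative_eq_intros DERIV_chain2[where f = G])
  have b: "norm (g (w\<^sup>2) * (2 * w)) \<le> 2 * C" if "w \<in> X" for w
  proof -
    have "norm w ^ 2 < sqrt r ^ 2"
      using that by (intro power_strict_mono) (auto simp: X_def)
    then have "norm w ^ 2 < r" using \<open>r > 0\<close> by simp
    then show ?thesis
      using bnd[of "w\<^sup>2"] W(2) that by (simp add: X_def norm_mult norm_power)
  qed
  have "(2 * \<bar>C\<bar>)-lipschitz_on X (\<lambda>w. G (w\<^sup>2))"
  proof (rule lipschitz_onI)
    fix v w assume "v \<in> X" "w \<in> X"
    then have "norm (G (v\<^sup>2) - G (w\<^sup>2)) \<le> 2 * C * norm (v - w)"
      using field_differentiable_bound[OF \<open>convex X\<close> d b] by blast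
    also have "\<dots> \<le> 2 * \<bar>C\<bar> * norm (v - w)" by (intro mult_right_mono) auto
    finally show "dist (G (v\<^sup>2)) (G (w\<^sup>2)) \<le> 2 * \<bar>C\<bar> * dist v w" by (simp add: dist_norm)
  qed simp
  then have uc: "uniformly_continuous_on X (\<lambda>w. G (w\<^sup>2))"
    by (rule lipschitz_on_uniformly_continuous)
  have lim: "filterlim csqrt (at 0 within X) (at 0 within T)"
  proof -
    have "((\<lambda>z. sqrt (norm z)) \<longlongrightarrow> sqrt (norm (0::complex))) (at 0 within T)"
      by (intro tendsto_intros)
    then have "(csqrt \<longlongrightarrow> 0) (at 0 within T)"
      by (subst tendsto_norm_zero_iff[symmetric]) simp
    moreover have "\<forall>\<^sub>F z in at 0 within T. csqrt z \<in> X \<and> csqrt z \<noteq> 0"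
    proof -
      have "\<forall>\<^sub>F z in at 0 within T. z \<in> T \<and> norm z < r"
        unfolding eventually_at using \<open>r > 0\<close> by (auto intro!: exI[of _ r])
      then show ?thesis
        by eventually_elim (use W(3) \<open>0 \<notin> T\<close> in \<open>auto simp: X_def\<close>)
    qed
    ultimately show ?thesis by (auto simp: filterlim_at)
  qed
  \<comment> \<open>A uniformly continuous function has limits at points of the closure. That
    \<open>0\<close> is one follows from the limit of \<open>csqrt\<close>, because
    \<open>at 0 within T\<close> is non-trivial in this case.\<close>
  have "0 \<in> closure X"
  proof -
    have "at 0 within X \<noteq> bot"
      using lim False by (auto simp: filterlim_def bot_unique filtermap_bot_iff)
    then show ?thesis by (simp add: trivial_limit_within closure_def)
  qed
  then obtain l where "((\<lambda>w. G (w\<^sup>2)) \<longlongrightarrow> l) (at 0 within X)"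
    using uniformly_continuous_on_extension_at_closure[OF uc] by blast
  from filterlim_compose[OF this lim] that show ?thesis by simp
qed

text \<open>The bound says that \<open>g\<close> grows at most like
  \<open>norm z powr (-1/2)\<close> at the origin. A primitive then has a limit at \<open>0\<close>
  from either half-plane, and the difference of the two limits is the integral along every
  loop.\<close>

lemma slit_loop_integral_unique:
  assumes g: "g holomorphic_on slit_plane" and "r > 0"
    and bnd: "\<And>z. z \<in> slit_plane \<Longrightarrow> norm z < r \<Longrightarrow> norm (g z) * sqrt (norm z) \<le> C"
  obtains I where "\<And>\<gamma>. slit_loop \<gamma> \<Longrightarrow> (g has_contour_integral I) \<gamma>"
proof -
  from slit_plane_primitive[OF g] obtain G
    where G: "\<And>z. z \<in> slit_plane \<Longrightarrow> (G has_field_derivative g z) (at z)" by blast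
  \<comment> \<open>The principal root maps the lower and the upper half-plane into the fourth and
    the first open quadrant; these convex sets serve as \<open>W\<close>.\<close>
  have "convex ({w. Re w > 0} \<inter> {w. Im w < 0})" "convex ({w. Re w > 0} \<inter> {w. Im w > 0})"
    by (intro convex_Int convex_halfspace_Re_gt convex_halfspace_Im_lt convex_halfspace_Im_gt)+
  then have quarter: "convex {w. 0 < Re w \<and> Im w < 0}" "convex {w. 0 < Re w \<and> Im w > 0}"
    by (simp_all add: Collect_conj_eq)
  have csq: "0 < Re (csqrt z)" "Im (csqrt z) < 0 \<longleftrightarrow> Im z < 0" "Im (csqrt z) > 0 \<longleftrightarrow> Im z > 0"
    if "Im z \<noteq> 0" for z
  proof -
    have "Re (csqrt z) \<noteq> 0"
      by (metis Im_power2 mult_eq_0_iff power2_csqrt that)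
    then show "0 < Re (csqrt z)" by (smt (verit) Re_csqrt)
    moreover have "Im z = 2 * Re (csqrt z) * Im (csqrt z)"
      by (metis Im_power2 power2_csqrt)
    ultimately show "Im (csqrt z) < 0 \<longleftrightarrow> Im z < 0" "Im (csqrt z) > 0 \<longleftrightarrow> Im z > 0"
      by (metis mult_less_cancel_left_pos mult_zero_right zero_less_mult_iff zero_less_numeral)+
  qed
  obtain l where l: "(G \<longlongrightarrow> l) (at 0 within {z. Im z < 0})"
  proof (rule primitive_tendsto_at_0[where T = "{z. Im z < 0}" and G = G and g = g and r = r and C = C
        and W = "{w. 0 < Re w \<and> Im w < 0}"])
    show "csqrt z \<in> {w. 0 < Re w \<and> Im w < 0}" if "z \<in> {z. Im z < 0}" for z
      using csq[of z] that by simp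
  qed (use G bnd quarter(1) \<open>r > 0\<close> in \<open>simp_all add: slit_plane_iff Im_power2 mult_less_0_iff\<close>)
  obtain u where u: "(G \<longlongrightarrow> u) (at 0 within {z. Im z > 0})"
  proof (rule primitive_tendsto_at_0[where T = "{z. Im z > 0}" and G = G and g = g and r = r and C = C
        and W = "{w. 0 < Re w \<and> Im w > 0}"])
    show "csqrt z \<in> {w. 0 < Re w \<and> Im w > 0}" if "z \<in> {z. Im z > 0}" for z
      using csq[of z] that by simp
  qed (use G bnd quarter \<open>r > 0\<close> in \<open>simp_all add: slit_plane_iff Im_power2\<close>)
  show ?thesis using that slit_loop_integral_primitive[OF _ G l u] by blast
qed

section \<open>Pochhammer's loop integral for the beta function\<close>

text \<open>Pochhammer's integrand, with Euler's convention for the exponent \<open>s - 1\<close>.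
  Apart from the exponential and the factor \<open>1 - y \<tau>\<close>, the kernel of the theorem
  is the case \<open>s = n/2 + 1/2\<close>, \<open>q = n/2\<close>.\<close>

definition beta_kern :: "real \<Rightarrow> real \<Rightarrow> complex \<Rightarrow> complex" where
  "beta_kern s q z = z powr of_real (s - 1) * (z - 1) powr of_real (- q)"

lemma norm_beta_kern: "norm (beta_kern s q z) = norm z powr (s - 1) * norm (z - 1) powr (- q)"
  unfolding beta_kern_def norm_mult by (subst (1 2) norm_powr_real_powr') auto

lemma holomorphic_beta_kern [holomorphic_intros]: "beta_kern s q holomorphic_on slit_plane"
  unfolding beta_kern_def
  by (intro holomorphic_intros) (auto dest: nonpos_Reals_slit_plane)

lemma powr_le_of_half_le:
  fixes x q :: real
  assumes "1 / 2 \<le> x" "x \<le> 2"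
  shows "x powr q \<le> 2 powr \<bar>q\<bar>"
proof -
  have "ln x \<le> ln 2" "ln (1/2) \<le> ln x" using assms by (subst ln_le_cancel_iff; simp)+
  then have "\<bar>ln x\<bar> \<le> ln 2" by (simp add: ln_div)
  then have "q * ln x \<le> \<bar>q\<bar> * ln 2"
    by (metis abs_ge_self abs_ge_zero abs_mult mult_left_mono order_trans)
  then show ?thesis using assms by (simp add: powr_def)
qed

text \<open>Near the origin \<open>norm (z - 1)\<close> lies between \<open>1/2\<close> and
  \<open>2\<close>, and what remains is \<open>norm z powr (s - 1/2)\<close>, at most
  \<open>1\<close>. The range \<open>s \<ge> 1/2\<close> covers \<open>s = n/2 + 1/2\<close> for
  every \<open>n > 0\<close>.\<close>

lemma beta_kern_bound:
  assumes "s \<ge> 1 / 2" "norm z < 1 / 2"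
  shows "norm (beta_kern s q z) * sqrt (norm z) \<le> 2 powr \<bar>q\<bar>"
proof -
  have z1: "1 / 2 \<le> norm (z - 1)" "norm (z - 1) \<le> 2"
    using assms(2) norm_triangle_ineq2[of 1 z] norm_triangle_ineq4[of z 1] by (auto simp: norm_minus_commute)
  have "norm z powr (s - 1) * sqrt (norm z) = norm z powr (s - 1 / 2)"
    by (cases "z = 0") (simp_all flip: powr_half_sqrt powr_add)
  also have "\<dots> \<le> 1" using assms by (intro powr_le1) auto
  finally have "norm z powr (s - 1) * sqrt (norm z) * norm (z - 1) powr (- q) \<le> 1 * 2 powr \<bar>q\<bar>"
    using powr_le_of_half_le[OF z1, of "- q"] by (intro mult_mono) auto
  then show ?thesis by (simp add: norm_beta_kern mult_ac)
qed

lemma beta_kern_integral_unique: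
  assumes "s \<ge> 1 / 2"
  obtains I where "\<And>\<gamma>. slit_loop \<gamma> \<Longrightarrow> (beta_kern s q has_contour_integral I) \<gamma>"
  using slit_loop_integral_unique[OF holomorphic_beta_kern, of "1/2"] beta_kern_bound[OF assms] by (metis half_gt_zero_iff zero_less_one)

lemma beta_kern_has_integral:
  "s \<ge> 1 / 2 \<Longrightarrow> slit_loop \<gamma> \<Longrightarrow> (beta_kern s q has_contour_integral contour_integral \<gamma> (beta_kern s q)) \<gamma>"
  by (meson beta_kern_integral_unique contour_integrable_on_def has_contour_integral_integral)

section \<open>Recurrences between the loop integrals\<close>

lemma has_field_derivative_beta_kern:
  assumes "z \<in> slit_plane"
  shows "(beta_kern (s + 1) q has_field_derivative
    of_real s * beta_kern s q z - of_real q * beta_kern (s + 1) (q + 1) z) (at z)"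
  unfolding beta_kern_def using nonpos_Reals_slit_plane[OF assms]
  by (auto intro!: derivative_eq_intros simp: algebra_simps minus_diff_commute)

lemma beta_kern_tendsto_0:
  assumes "s > 0"
  shows "(beta_kern (s + 1) q \<longlongrightarrow> 0) (at 0 within T)"
proof (rule Lim_null_comparison)
  show "\<forall>\<^sub>F z in at 0 within T. norm (beta_kern (s + 1) q z) \<le> norm z powr s * 2 powr \<bar>q\<bar>"
    unfolding eventually_at
  proof (intro exI[of _ "1/2"] conjI ballI impI)
    fix z :: complex assume z: "z \<noteq> 0 \<and> dist z 0 < 1 / 2"
    have z1: "1 / 2 \<le> norm (z - 1)" "norm (z - 1) \<le> 2"
      using z norm_triangle_ineq2[of 1 z] norm_triangle_ineq4[of z 1] by (auto simp: norm_minus_commute)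
    show "norm (beta_kern (s + 1) q z) \<le> norm z powr s * 2 powr \<bar>q\<bar>"
      using powr_le_of_half_le[OF z1, of "- q"] by (simp add: norm_beta_kern mult_left_mono)
  qed simp
  have "((\<lambda>z. norm z powr s * 2 powr \<bar>q\<bar>) \<longlongrightarrow> norm (0::complex) powr s * 2 powr \<bar>q\<bar>) (at 0 within T)"
    using assms by (intro tendsto_intros tendsto_powr') auto
  then show "((\<lambda>z. norm z powr s * 2 powr \<bar>q\<bar>) \<longlongrightarrow> 0) (at (0::complex) within T)" using assms by simp
qed

text \<open>The derivative of \<open>beta_kern (s + 1) q\<close> integrates to zero, since this
  primitive tends to zero at the origin from both sides of the cut. The two terms of the product
  rule are the two sides of the equation.\<close>

lemma beta_kern_integral_shift_both:
  assumes "s \<ge> 1 / 2" "slit_loop \<gamma>"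
  shows "of_real s * contour_integral \<gamma> (beta_kern s q) =
    of_real q * contour_integral \<gamma> (beta_kern (s + 1) (q + 1))"
proof -
  have "((\<lambda>z. of_real s * beta_kern s q z - of_real q * beta_kern (s + 1) (q + 1) z)
    has_contour_integral 0 - 0) \<gamma>"
    using assms by (intro slit_loop_integral_primitive[where G = "beta_kern (s + 1) q"] has_field_derivative_beta_kern beta_kern_tendsto_0) auto
  moreover have "((\<lambda>z. of_real s * beta_kern s q z - of_real q * beta_kern (s + 1) (q + 1) z)
    has_contour_integral of_real s * contour_integral \<gamma> (beta_kern s q) -
      of_real q * contour_integral \<gamma> (beta_kern (s + 1) (q + 1))) \<gamma>"
    using assms by (intro has_contour_integral_diff has_contour_integral_lmul beta_kern_has_integral) auto
  ultimately show ?thesis using has_contour_integral_unique by fastforce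
qed

text \<open>At the branch point \<open>0\<close> the power has a default value, so identities
  between integrands are available only in the slit plane. A loop stays there for all parameters
  strictly between \<open>0\<close> and \<open>1\<close>, and the two endpoints form a null
  set.\<close>

lemma has_contour_integral_cong_slit_loop:
  assumes "(f has_contour_integral I) \<gamma>" "slit_loop \<gamma>" "\<And>z. z \<in> slit_plane \<Longrightarrow> g z = f z"
  shows "(g has_contour_integral I) \<gamma>"
  using assms unfolding has_contour_integral slit_loop_def
  by (metis (no_types, lifting) has_integral_spike_interior box_real cbox_interval)

text \<open>Multiplication by \<open>z - 1\<close> lowers \<open>q\<close> by one; expanding this
  factor writes the integral for \<open>(s, q - 1)\<close> as the one for \<open>(s + 1, q)\<close>
  minus the one for \<open>(s, q)\<close>. The previous recurrence at \<open>q - 1\<close>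
  eliminates the first of the three.\<close>

lemma beta_kern_integral_shift:
  assumes "s \<ge> 1 / 2" "slit_loop \<gamma>"
  shows "of_real (s + 1 - q) * contour_integral \<gamma> (beta_kern (s + 1) q) =
    of_real s * contour_integral \<gamma> (beta_kern s q)"
proof -
  have eq: "beta_kern s (q - 1) z = beta_kern (s + 1) q z - beta_kern s q z" if "z \<in> slit_plane" for z
  proof -
    note z = nonpos_Reals_slit_plane[OF that]
    have "z powr of_real s = z powr of_real (s - 1) * z"
      using powr_add[of z "of_real (s - 1)" 1] z by simp
    moreover have "(z - 1) powr of_real (- (q - 1)) = (z - 1) powr of_real (- q) * (z - 1)"
      using powr_add[of "z - 1" "of_real (- q)" 1] z by simp
    ultimately have "beta_kern s (q - 1) z =
        z powr of_real (s - 1) * ((z - 1) powr of_real (- q) * (z - 1))"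
      and "beta_kern (s + 1) q z = z powr of_real (s - 1) * z * (z - 1) powr of_real (- q)"
      by (simp_all only: beta_kern_def add_diff_cancel_right')
    then show ?thesis unfolding beta_kern_def by (simp only: left_diff_distrib right_diff_distrib mult_1_left mult_ac)
  qed
  have "((\<lambda>z. beta_kern (s + 1) q z - beta_kern s q z) has_contour_integral
      contour_integral \<gamma> (beta_kern (s + 1) q) - contour_integral \<gamma> (beta_kern s q)) \<gamma>"
    using assms by (intro has_contour_integral_diff beta_kern_has_integral) auto
  then have "(beta_kern s (q - 1) has_contour_integral
      contour_integral \<gamma> (beta_kern (s + 1) q) - contour_integral \<gamma> (beta_kern s q)) \<gamma>"
    by (rule has_contour_integral_cong_slit_loop) (use assms eq in auto)
  then have "contour_integral \<gamma> (beta_kern s (q - 1)) =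
      contour_integral \<gamma> (beta_kern (s + 1) q) - contour_integral \<gamma> (beta_kern s q)"
    by (rule contour_integral_unique)
  with beta_kern_integral_shift_both[OF assms, of "q - 1"] show ?thesis
    by (simp add: algebra_simps)
qed

text \<open>The radius is negative so that the circle starts at \<open>0\<close> rather than at
  \<open>\<rho>\<close>; its orientation stays anti-clockwise. At \<open>t = 1/2\<close> it crosses
  the real axis in \<open>\<rho>\<close>, beyond the branch point because
  \<open>\<rho> > 1\<close>.\<close>

lemma slit_loop_circlepath:
  assumes "\<rho> > 1"
  shows "slit_loop (circlepath (of_real (\<rho> / 2)) (- \<rho> / 2))"
proof -
  define \<gamma> where "\<gamma> = circlepath (complex_of_real (\<rho> / 2)) (- \<rho> / 2)"
  have \<gamma>: "\<gamma> t = of_real (\<rho> / 2) * (1 - exp (\<i> * of_real (2 * pi * t)))" for t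
    by (simp add: \<gamma>_def circlepath algebra_simps)
  have im: "Im (\<gamma> t) = - \<rho> / 2 * sin (2 * pi * t)" and re: "Re (\<gamma> t) = \<rho> / 2 * (1 - cos (2 * pi * t))" for t
    by (simp_all add: \<gamma> Im_exp Re_exp)
  have neg: "Im (\<gamma> t) < 0" if "0 < t" "t < 1 / 2" for t
    using that assms sin_gt_zero[of "2 * pi * t"] by (simp add: im)
  have pos: "Im (\<gamma> t) > 0" if "1 / 2 < t" "t < 1" for t
  proof -
    have "sin (2 * pi * t - pi) > 0" using that by (intro sin_gt_zero) (auto simp: field_simps)
    then have "sin (2 * pi * t) < 0" by (simp add: sin_diff)
    then show ?thesis using assms by (simp add: im mult_less_0_iff)
  qed
  have "\<gamma> t \<in> slit_plane" if "0 < t" "t < 1" for t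
  proof (cases "t = 1 / 2")
    case True
    then have "cos (2 * pi * t) = cos pi" by (intro arg_cong[of _ _ cos]) simp
    then show ?thesis using assms by (simp add: slit_plane_iff re)
  next
    case False
    then have "t < 1 / 2 \<or> 1 / 2 < t" by linarith
    then have "Im (\<gamma> t) \<noteq> 0" using neg[of t] pos[of t] that by fastforce
    then show ?thesis by (simp add: slit_plane_iff)
  qed
  moreover have "\<forall>\<^sub>F t in at_right 0. Im (\<gamma> t) < 0"
    by (rule eventually_mono[OF eventually_at_right_real[of 0 "1/2"]]) (use neg in auto)
  moreover have "\<forall>\<^sub>F t in at_left 1. Im (\<gamma> t) > 0"
    by (rule eventually_mono[OF eventually_at_left_real[of "1/2" 1]]) (use pos in auto)
  moreover have "valid_path \<gamma>" "pathstart \<gamma> = 0" "pathfinish \<gamma> = 0"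
    by (simp_all add: \<gamma>_def)
  ultimately show ?thesis unfolding slit_loop_def \<gamma>_def by simp
qed

section \<open>The binomial series and the unit circle around \<open>1\<close>\<close>

lemma Gamma_plus1_pos: "Gamma (x + 1) = x * Gamma x" if "x > 0" for x :: real
  using that by (intro Gamma_plus1) (auto elim!: nonpos_Ints_cases)

lemma of_real_gbinomial: "of_real (a gchoose k) = (of_real a gchoose k :: complex)"
  by (simp add: gbinomial_prod_rev)

text \<open>The coefficients are of order \<open>k powr (- (a + 1))\<close>, so \<open>a > 0\<close>
  gives absolute convergence up to the boundary of the unit disc.\<close>

lemma summable_abs_gbinomial:
  fixes a :: real
  assumes "a > 0"
  shows "summable (\<lambda>k. \<bar>a gchoose k\<bar>)"
proof -
  have "Bseq (\<lambda>k. (a gchoose k) / ((- 1) ^ k / exp ((a + 1) * of_real (ln (real k)))))"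
    by (rule convergent_imp_Bseq[OF convergentI[OF gbinomial_asymptotic]])
  then obtain M where M: "\<And>k. norm ((a gchoose k) / ((- 1) ^ k / exp ((a + 1) * of_real (ln (real k))))) \<le> M"
    by (auto simp: Bseq_def)
  show ?thesis
  proof (rule summable_comparison_test_ev)
    have "\<bar>a gchoose k\<bar> \<le> M * real k powr (- (a + 1))" if "k > 0" for k
    proof -
      have "\<bar>a gchoose k\<bar> * real k powr (a + 1) \<le> M"
        using M[of k] that by (simp add: abs_mult power_abs powr_def)
      then have "\<bar>a gchoose k\<bar> \<le> M / real k powr (a + 1)" using that by (simp add: pos_le_divide_eq)
      then show ?thesis by (simp only: powr_minus divide_inverse)
    qed
    then show "\<forall>\<^sub>F k in sequentially. norm \<bar>a gchoose k\<bar> \<le> M * real k powr (- (a + 1))"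
      by (intro eventually_mono[OF eventually_gt_at_top[of 0]]) auto
    show "summable (\<lambda>k. M * real k powr (- (a + 1)))"
      using assms by (intro summable_mult) (simp add: summable_real_powr_iff)
  qed
qed

text \<open>Absolutely summable coefficients make the series converge uniformly along the radius to
  \<open>w\<close>, hence continuous up to \<open>r = 1\<close>, while for \<open>r < 1\<close> the
  classical series applies. For \<open>w \<noteq> -1\<close> the point \<open>1 + w\<close> avoids
  the cut, so the power is continuous as well.\<close>

lemma gbinomial_sums_unit_circle:
  assumes a: "a > 0" and w: "norm w = 1" "w \<noteq> -1"
  shows "(\<lambda>k. (complex_of_real a gchoose k) * w ^ k) sums (1 + w) powr of_real a"
proof -
  let ?f = "\<lambda>r. \<Sum>k. (complex_of_real a gchoose k) * (of_real r * w) ^ k"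
  have sm: "summable (\<lambda>k. norm (complex_of_real a gchoose k))"
    using summable_abs_gbinomial[OF a] by (simp flip: of_real_gbinomial)
  have "uniform_limit {0..1} (\<lambda>n r. \<Sum>k<n. (complex_of_real a gchoose k) * (of_real r * w) ^ k) ?f sequentially"
    by (rule Weierstrass_m_test[OF _ sm])
      (use w in \<open>auto simp: norm_mult norm_power intro!: mult_left_le power_le_one\<close>)
  then have "continuous_on {0..1} ?f"
    by (rule uniform_limit_theorem[rotated]) (auto intro!: always_eventually continuous_intros)
  then have "(?f \<longlongrightarrow> ?f 1) (at 1 within {0..1})" unfolding continuous_on_def by (rule bspec) simp
  then have "(?f \<longlongrightarrow> ?f 1) (at_left 1)" by (simp only: at_within_Icc_at_left zero_less_one)
  moreover have "\<forall>\<^sub>F r in at_left 1. ?f r = (1 + of_real r * w) powr of_real a"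
    by (rule eventually_mono[OF eventually_at_left_real[of 0 "1::real"]]) (use w in \<open>auto simp: norm_mult intro!: sums_unique[symmetric] gen_binomial_complex\<close>)
  ultimately have "((\<lambda>r. (1 + of_real r * w) powr of_real a) \<longlongrightarrow> ?f 1) (at_left 1)"
    by (simp add: tendsto_cong)
  moreover have "((\<lambda>r. (1 + of_real r * w) powr of_real a) \<longlongrightarrow> (1 + of_real 1 * w) powr of_real a) (at_left 1)"
  proof -
    have "1 + w \<notin> \<real>\<^sub>\<le>\<^sub>0"
    proof
      assume "1 + w \<in> \<real>\<^sub>\<le>\<^sub>0"
      then have "Re w \<le> -1" "Im w = 0" by (auto simp: complex_nonpos_Reals_iff)
      moreover have "\<bar>Re w\<bar> \<le> 1" using abs_Re_le_cmod[of w] w by simp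
      ultimately have "w = -1" by (auto simp: complex_eq_iff)
      with w show False by simp
    qed
    then show ?thesis by (intro tendsto_intros) auto
  qed
  ultimately have "?f 1 = (1 + w) powr of_real a"
    using tendsto_unique trivial_limit_at_left_real by fastforce
  moreover have "summable (\<lambda>k. (complex_of_real a gchoose k) * w ^ k)"
    by (rule summable_norm_cancel) (use sm w in \<open>simp add: norm_mult norm_power\<close>)
  ultimately show ?thesis by (simp add: sums_iff)
qed

text \<open>On the circle \<open>z = 1 + w\<close> the factor \<open>z powr (s - 1)\<close> is a
  binomial series in \<open>w\<close>, and with \<open>dz = 2 pi i w dt\<close> each term becomes a
  pure exponential. The sum of the moduli of the coefficients dominates all partial sums.\<close>

lemma beta_kern_unit_circle_sums:
  assumes s: "s > 1"
  shows "(\<lambda>k. complex_of_real (s - 1 gchoose k) *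
      integral {0..1} (\<lambda>t. exp (\<i> * of_real ((real k + 1 - q) * (2 * pi * t - pi))))) sums
    (contour_integral (circlepath 1 (- 1)) (beta_kern s q) / (2 * of_real pi * \<i>))"
proof -
  \<comment> \<open>\<open>w t\<close> equals \<open>- exp (2 pi i t)\<close>. The angle
    \<open>2 pi t - pi\<close> lies in the principal range for \<open>0 < t < 1\<close>, which makes
    \<open>Ln (w t)\<close> explicit.\<close>
  define w where "w = (\<lambda>t. exp (\<i> * of_real (2 * pi * t - pi)))"
  \<comment> \<open>For \<open>0 < t < 1\<close> this is the principal power of \<open>w t\<close>
    with exponent \<open>k + 1 - q\<close>; the summand \<open>1\<close> comes from the derivative
    of the path.\<close>
  define e where "e = (\<lambda>k t. exp (\<i> * of_real ((real k + 1 - q) * (2 * pi * t - pi))))"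
  define c where "c = (\<lambda>k. complex_of_real (s - 1 gchoose k))"
  have e: "e k t = w t ^ k * e 0 t" for k t
    by (simp add: e_def w_def algebra_simps flip: exp_of_nat_mult exp_add)
  have nw: "norm (w t) = 1" "norm (e k t) = 1" for t k
    by (simp_all add: w_def e_def del: of_real_mult of_real_diff)
  have sm: "summable (\<lambda>k. norm (c k))"
    using summable_abs_gbinomial[of "s - 1"] s by (simp add: c_def)
  have int_e: "e k integrable_on {0..1}" for k
    unfolding e_def by (intro integrable_continuous_real continuous_intros)
  let ?g = "\<lambda>t. \<Sum>k. c k * e k t"
  have lim: "(\<lambda>N. integral {0..1} (\<lambda>t. \<Sum>k<N. c k * e k t)) \<longlonglongrightarrow> integral {0..1} ?g"
  proof (rule dominated_convergence(2)[where h = "\<lambda>_. \<Sum>k. norm (c k)"])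
    show "(\<lambda>t. \<Sum>k<N. c k * e k t) integrable_on {0..1}" for N
      by (intro integrable_sum integrable_on_mult_right int_e) auto
    show "norm (\<Sum>k<N. c k * e k t) \<le> (\<Sum>k. norm (c k))" for N t
    proof -
      have "norm (\<Sum>k<N. c k * e k t) \<le> (\<Sum>k<N. norm (c k * e k t))" by (rule norm_sum)
      also have "\<dots> = (\<Sum>k<N. norm (c k))" by (simp add: norm_mult nw)
      also have "\<dots> \<le> (\<Sum>k. norm (c k))" by (rule sum_le_suminf[OF sm]) auto
      finally show ?thesis .
    qed
    show "(\<lambda>N. \<Sum>k<N. c k * e k t) \<longlonglongrightarrow> ?g t" for t
      by (intro summable_LIMSEQ summable_norm_cancel[of "\<lambda>k. c k * e k t"]) (use sm in \<open>simp add: norm_mult nw\<close>)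
  qed auto
  have "integral {0..1} (\<lambda>t. \<Sum>k<N. c k * e k t) = (\<Sum>k<N. c k * integral {0..1} (e k))" for N
    by (subst integral_sum) (auto intro!: integrable_on_mult_right int_e)
  with lim have *: "(\<lambda>k. c k * integral {0..1} (e k)) sums integral {0..1} ?g"
    by (simp add: sums_def)
  have eq: "beta_kern s q (circlepath 1 (- 1) t) * vector_derivative (circlepath 1 (- 1)) (at t) =
      2 * of_real pi * \<i> * ?g t" if t: "0 < t" "t < 1" for t
  proof -
    have w: "- exp (2 * of_real pi * \<i> * of_real t) = w t"
      by (simp add: w_def algebra_simps exp_diff)
    have t': "- pi < 2 * pi * t - pi" "2 * pi * t - pi < pi" using t by auto
    have Lnw: "Ln (w t) = \<i> * of_real (2 * pi * t - pi)"
      unfolding w_def by (rule Ln_exp) (use t' in auto)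
    have "w t \<noteq> -1"
    proof
      assume "w t = -1"
      then have "Ln (w t) = \<i> * of_real pi" by simp
      with Lnw have "2 * pi * t - pi = pi" by (metis complex_i_not_zero mult_left_cancel of_real_eq_iff)
      with t' show False by simp
    qed
    then have "(\<lambda>k. c k * w t ^ k) sums (1 + w t) powr of_real (s - 1)"
      unfolding c_def of_real_gbinomial by (intro gbinomial_sums_unit_circle) (use s nw in auto)
    then have "(\<lambda>k. c k * w t ^ k * e 0 t) sums ((1 + w t) powr of_real (s - 1) * e 0 t)"
      by (rule sums_mult2)
    then have g: "?g t = (1 + w t) powr of_real (s - 1) * e 0 t"
      by (subst e) (simp add: sums_iff mult_ac)
    have "w t powr of_real (- q) * w t = e 0 t"
    proof -
      have "w t \<noteq> 0" by (simp add: w_def)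
      then have "w t powr of_real (- q) = exp (of_real (- q) * (\<i> * of_real (2 * pi * t - pi)))"
        by (simp only: powr_def Lnw if_False)
      then show ?thesis by (simp add: w_def e_def algebra_simps flip: exp_add)
    qed
    moreover have "circlepath 1 (- 1) t = 1 + w t" by (simp add: circlepath w flip: w)
    moreover have "vector_derivative (circlepath 1 (- 1)) (at t) = 2 * of_real pi * \<i> * w t"
      by (simp add: vector_derivative_circlepath flip: w)
    ultimately show ?thesis by (simp add: beta_kern_def g mult_ac)
  qed
  have "contour_integral (circlepath 1 (- 1)) (beta_kern s q) = integral {0..1} (\<lambda>t. 2 * of_real pi * \<i> * ?g t)"
    unfolding contour_integral_integral
    by (rule integral_spike[of "{0,1}"]) (use eq in auto)
  also have "\<dots> = 2 * of_real pi * \<i> * integral {0..1} ?g" by simp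
  finally show ?thesis using * by (simp add: c_def e_def)
qed

lemma integral_cis_symmetric:
  fixes \<beta> :: real
  shows "integral {0..1} (\<lambda>t. exp (\<i> * of_real (\<beta> * (2 * pi * t - pi)))) =
    (if \<beta> = 0 then 1 else of_real (sin (pi * \<beta>) / (pi * \<beta>)))"
proof (cases "\<beta> = 0")
  case False
  let ?F = "\<lambda>t. exp (\<i> * of_real (\<beta> * (2 * pi * t - pi))) / (\<i> * of_real (2 * pi * \<beta>))"
  have "((\<lambda>t. exp (\<i> * of_real (\<beta> * (2 * pi * t - pi)))) has_integral ?F 1 - ?F 0) {0..1}"
  proof (rule fundamental_theorem_of_calculus)
    fix t :: real
    have "((\<lambda>z. exp (\<i> * (of_real \<beta> * (2 * of_real pi * z - of_real pi))) / (\<i> * of_real (2 * pi * \<beta>)))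
        has_field_derivative exp (\<i> * (of_real \<beta> * (2 * of_real pi * of_real t - of_real pi)))) (at (of_real t))"
      using False by (auto intro!: derivative_eq_intros simp: field_simps)
    from has_vector_derivative_real_field[OF this]
    show "(?F has_vector_derivative exp (\<i> * of_real (\<beta> * (2 * pi * t - pi)))) (at t within {0..1})"
      by simp
  qed simp
  moreover have "?F 1 - ?F 0 = of_real (sin (pi * \<beta>) / (pi * \<beta>))"
    using False by (simp add: complex_eq_iff Re_divide Im_divide Re_exp Im_exp field_simps power2_eq_square)
  ultimately show ?thesis using False by (simp add: integral_unique)
qed simp

text \<open>Expand \<open>(1 - u) powr (s - 1)\<close> in Euler's integral and integrate termwise.
  The majorant is a multiple of \<open>u powr (z - 1)\<close>, integrable because
  \<open>z > 0\<close>.\<close>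

lemma integral_Beta_gbinomial_sums:
  fixes s z :: real
  assumes "s > 1" "z > 0"
  shows "(\<lambda>k. (s - 1 gchoose k) * (- 1) ^ k / (real k + z)) sums Beta s z"
proof -
  define c where "c = (\<lambda>k. (s - 1 gchoose k) * (- 1) ^ k)"
  have sm: "summable (\<lambda>k. norm (c k))"
    using summable_abs_gbinomial[of "s - 1"] assms by (simp add: c_def abs_mult power_abs)
  have pw: "((\<lambda>u. u powr (real k + z - 1)) has_integral 1 / (real k + z)) {0..1}" for k
    using has_integral_powr_from_0[of "real k + z - 1" 1] assms by simp
  let ?g = "\<lambda>u. u powr (z - 1) * (1 - u) powr (s - 1)"
  have lim: "(\<lambda>N. integral {0<..<1} (\<lambda>u. \<Sum>k<N. c k * u powr (real k + z - 1))) \<longlonglongrightarrow> integral {0<..<1} ?g"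
  proof (rule dominated_convergence(2)[where h = "\<lambda>u. (\<Sum>k. norm (c k)) * u powr (z - 1)"])
    show "(\<lambda>u. \<Sum>k<N. c k * u powr (real k + z - 1)) integrable_on {0<..<1}" for N
      unfolding integrable_on_open_interval_real using pw
      by (intro integrable_sum integrable_on_mult_right) (auto simp: integrable_on_def)
    show "(\<lambda>u. (\<Sum>k. norm (c k)) * u powr (z - 1)) integrable_on {0<..<1}"
      unfolding integrable_on_open_interval_real using pw[of 0]
      by (intro integrable_on_mult_right) (auto simp: integrable_on_def)
    fix u :: real assume u: "u \<in> {0<..<1}"
    have up: "u powr (real k + z - 1) = u ^ k * u powr (z - 1)" for k
      using u by (simp add: powr_realpow[symmetric] flip: powr_add) (simp add: algebra_simps)
    show "norm (\<Sum>k<N. c k * u powr (real k + z - 1)) \<le> (\<Sum>k. norm (c k)) * u powr (z - 1)" for N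
    proof -
      have "norm (\<Sum>k<N. c k * u powr (real k + z - 1)) \<le> (\<Sum>k<N. norm (c k * u powr (real k + z - 1)))" by (rule norm_sum)
      also have "\<dots> \<le> (\<Sum>k<N. norm (c k) * u powr (z - 1))"
        using u by (intro sum_mono) (auto simp: up abs_mult intro!: mult_left_mono mult_left_le_one_le power_le_one)
      also have "\<dots> = (\<Sum>k<N. norm (c k)) * u powr (z - 1)" by (simp add: sum_distrib_right)
      also have "\<dots> \<le> (\<Sum>k. norm (c k)) * u powr (z - 1)"
        by (intro mult_right_mono sum_le_suminf[OF sm]) auto
      finally show ?thesis .
    qed
    have "(\<lambda>k. (s - 1 gchoose k) * (- u) ^ k) sums (1 + - u) powr (s - 1)"
      using u by (intro gen_binomial_real) auto
    then have "(\<lambda>k. (s - 1 gchoose k) * (- u) ^ k * u powr (z - 1)) sums ((1 + - u) powr (s - 1) * u powr (z - 1))"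
      by (rule sums_mult2)
    then have "(\<lambda>k. c k * u powr (real k + z - 1)) sums ?g u"
      by (simp add: up c_def power_minus[of u] mult_ac)
    then show "(\<lambda>N. \<Sum>k<N. c k * u powr (real k + z - 1)) \<longlonglongrightarrow> ?g u"
      by (simp add: sums_def)
  qed
  have "integral {0<..<1} (\<lambda>u. \<Sum>k<N. c k * u powr (real k + z - 1)) = (\<Sum>k<N. c k / (real k + z))" for N
  proof -
    have "((\<lambda>u. \<Sum>k<N. c k * u powr (real k + z - 1)) has_integral (\<Sum>k<N. c k * (1 / (real k + z)))) {0..1}"
      by (intro has_integral_sum has_integral_mult_right pw) auto
    then show ?thesis
      using integral_open_interval_real[of 0 1 "\<lambda>u. \<Sum>k<N. c k * u powr (real k + z - 1)"]
      by (simp add: integral_unique)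
  qed
  moreover have "integral {0<..<1} ?g = Beta s z"
    using has_integral_Beta_real[of z s] assms
      integral_open_interval_real[of 0 1 ?g]
    by (simp add: integral_unique Beta_commute)
  ultimately show ?thesis using lim by (simp add: sums_def c_def)
qed

text \<open>For \<open>q < 1\<close> the sines are \<open>sin (pi q)\<close> up to alternating
  signs, so the series is a multiple of the one for \<open>Beta s (1 - q)\<close>, and Euler's
  reflection formula produces the Gamma quotient. For \<open>q = 1\<close> that Beta argument
  degenerates, but only the term \<open>k = 0\<close> survives.\<close>

lemma beta_kern_integral_unit_circle:
  assumes s: "s > 1" and q: "0 < q" "q \<le> 1"
  shows "contour_integral (circlepath 1 (- 1)) (beta_kern s q) =
    2 * of_real pi * \<i> * of_real (Gamma s / (Gamma (s - q + 1) * Gamma q))"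
proof -
  have sums: "(\<lambda>k. complex_of_real (s - 1 gchoose k) *
      (if real k + 1 - q = 0 then 1 else of_real (sin (pi * (real k + 1 - q)) / (pi * (real k + 1 - q))))) sums
    (contour_integral (circlepath 1 (- 1)) (beta_kern s q) / (2 * of_real pi * \<i>))"
    using beta_kern_unit_circle_sums[OF s, of q] unfolding integral_cis_symmetric .
  have "(contour_integral (circlepath 1 (- 1)) (beta_kern s q) / (2 * of_real pi * \<i>)) =
      of_real (Gamma s / (Gamma (s - q + 1) * Gamma q))"
  proof (cases "q = 1")
    case True
    have "(\<lambda>k. complex_of_real (s - 1 gchoose k) *
      (if real k + 1 - q = 0 then 1 else of_real (sin (pi * (real k + 1 - q)) / (pi * (real k + 1 - q))))) =
      (\<lambda>k. if k = 0 then 1 else 0)"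
      using True by (auto simp: sin_npi2)
    with sums have "(\<lambda>k::nat. if k = 0 then 1 else 0) sums
        (contour_integral (circlepath 1 (- 1)) (beta_kern s q) / (2 * of_real pi * \<i>))" by simp
    then have "contour_integral (circlepath 1 (- 1)) (beta_kern s q) / (2 * of_real pi * \<i>) = 1"
      using sums_single[of 0 "\<lambda>_. 1::complex"] sums_unique2 by blast
    moreover have "Gamma s \<noteq> 0" using s Gamma_real_pos[of s] by linarith
    ultimately show ?thesis using True by simp
  next
    case False
    then have q: "0 < q" "q < 1" using q by auto
    have sn: "sin (pi * (real k + 1 - q)) = (- 1) ^ k * sin (pi * q)" for k
    proof -
      have "sin (pi * (real k + 1 - q)) = sin (real (Suc k) * pi + - (pi * q))" by (simp add: algebra_simps)
      also have "\<dots> = (- 1) ^ k * sin (pi * q)" by (subst sin_add, subst sin_npi, subst cos_npi) simp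
      finally show ?thesis .
    qed
    have "(\<lambda>k. sin (pi * q) / pi * ((s - 1 gchoose k) * (- 1) ^ k / (real k + (1 - q)))) sums
        (sin (pi * q) / pi * Beta s (1 - q))"
      by (intro sums_mult integral_Beta_gbinomial_sums) (use q s in auto)
    then have "(\<lambda>k. complex_of_real (sin (pi * q) / pi * ((s - 1 gchoose k) * (- 1) ^ k / (real k + (1 - q))))) sums
        of_real (sin (pi * q) / pi * Beta s (1 - q))"
      by (rule sums_of_real)
    moreover have "complex_of_real (s - 1 gchoose k) *
        (if real k + 1 - q = 0 then 1 else of_real (sin (pi * (real k + 1 - q)) / (pi * (real k + 1 - q)))) =
        complex_of_real (sin (pi * q) / pi * ((s - 1 gchoose k) * (- 1) ^ k / (real k + (1 - q))))" for k
      using q unfolding sn by (simp add: field_simps)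
    ultimately have "contour_integral (circlepath 1 (- 1)) (beta_kern s q) / (2 * of_real pi * \<i>) =
        of_real (sin (pi * q) / pi * Beta s (1 - q))"
      using sums sums_unique2 by simp
    also have "sin (pi * q) / pi * Beta s (1 - q) = Gamma s / (Gamma (s - q + 1) * Gamma q)"
    proof -
      have "complex_of_real (Gamma q * Gamma (1 - q)) = of_real (pi / sin (pi * q))"
        using Gamma_reflection_complex[of "of_real q"] by (simp flip: Gamma_complex_of_real sin_of_real)
      then have refl: "Gamma q * Gamma (1 - q) = pi / sin (pi * q)" by (simp only: of_real_eq_iff)
      have "sin (pi * q) > 0" using q by (intro sin_gt_zero) auto
      moreover have "Gamma q > 0" using q by (simp add: Gamma_real_pos)
      ultimately have "Gamma (1 - q) = pi / (sin (pi * q) * Gamma q)" using refl by (simp add: field_simps)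
      then show ?thesis using \<open>sin (pi * q) > 0\<close> by (simp add: Beta_def field_simps)
    qed
    finally show ?thesis .
  qed
  then show ?thesis by (simp add: field_simps)
qed

text \<open>Two recurrences lead to the parameters of the unit circle. Raising \<open>s\<close> by
  one enforces \<open>s > 1\<close> when \<open>q \<le> 1\<close>; lowering \<open>s\<close> and
  \<open>q\<close> together brings \<open>q\<close> into that range by induction and preserves
  \<open>s - q\<close>, hence the hypothesis \<open>s \<ge> q + 1/2\<close>.\<close>

lemma beta_kern_loop_integral:
  assumes "q > 0" "s \<ge> q + 1 / 2" "slit_loop \<gamma>"
  shows "(beta_kern s q has_contour_integral 2 * of_real pi * \<i> * of_real (Gamma s / (Gamma (s - q + 1) * Gamma q))) \<gamma>"
proof -
  have base: "contour_integral \<gamma> (beta_kern s q) =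
      2 * of_real pi * \<i> * of_real (Gamma s / (Gamma (s - q + 1) * Gamma q))"
    if q: "0 < q" "q \<le> 1" and s: "s \<ge> q + 1 / 2" for s q
  proof -
    \<comment> \<open>With diameter \<open>2\<close> the circle through the origin is the unit
      circle around \<open>1\<close>; loop independence lets it replace
      \<open>\<gamma>\<close>.\<close>
    have sl: "slit_loop (circlepath 1 (- 1))" using slit_loop_circlepath[of 2] by simp
    obtain I where I: "\<And>\<gamma>. slit_loop \<gamma> \<Longrightarrow> (beta_kern (s + 1) q has_contour_integral I) \<gamma>"
      using beta_kern_integral_unique[of "s + 1" q] q s by auto
    have "contour_integral \<gamma> (beta_kern (s + 1) q) = contour_integral (circlepath 1 (- 1)) (beta_kern (s + 1) q)"
      using I[OF assms(3)] I[OF sl] by (simp add: contour_integral_unique)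
    also have "\<dots> = 2 * of_real pi * \<i> * of_real (Gamma (s + 1) / (Gamma (s + 1 - q + 1) * Gamma q))"
      by (rule beta_kern_integral_unit_circle) (use q s in auto)
    finally have eq: "contour_integral \<gamma> (beta_kern (s + 1) q) =
        2 * of_real pi * \<i> * of_real (Gamma (s + 1) / (Gamma (s + 1 - q + 1) * Gamma q))" .
    have G1: "Gamma (s + 1) = s * Gamma s" using q s by (intro Gamma_plus1_pos) auto
    have G2: "Gamma (s + 1 - q + 1) = (s + 1 - q) * Gamma (s + 1 - q)"
      using q s by (intro Gamma_plus1_pos) auto
    have nz: "s + 1 - q \<noteq> 0" "s \<noteq> 0" using q s by auto
    have G: "(s + 1 - q) * (Gamma (s + 1) / (Gamma (s + 1 - q + 1) * Gamma q)) =
        s * (Gamma s / (Gamma (s - q + 1) * Gamma q))"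
    proof -
      have "Gamma (s - q + 1) = Gamma (s + 1 - q)" by (rule arg_cong[of _ _ Gamma]) simp
      then show ?thesis unfolding G1 G2 using nz by simp
    qed
    have "of_real s * contour_integral \<gamma> (beta_kern s q) = 2 * of_real pi * \<i> *
        of_real ((s + 1 - q) * (Gamma (s + 1) / (Gamma (s + 1 - q + 1) * Gamma q)))"
      using beta_kern_integral_shift[of s \<gamma> q] q s assms(3) unfolding eq of_real_mult
      by (simp only: mult_ac)
    also have "\<dots> = of_real s *
        (2 * of_real pi * \<i> * of_real (Gamma s / (Gamma (s - q + 1) * Gamma q)))"
      unfolding G of_real_mult by (simp only: mult_ac)
    finally have "of_real s * contour_integral \<gamma> (beta_kern s q) = of_real s *
        (2 * of_real pi * \<i> * of_real (Gamma s / (Gamma (s - q + 1) * Gamma q)))" .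
    then show ?thesis using nz by (metis mult_left_cancel of_real_eq_0_iff)
  qed
  have "contour_integral \<gamma> (beta_kern s q) =
      2 * of_real pi * \<i> * of_real (Gamma s / (Gamma (s - q + 1) * Gamma q))"
    if "0 < q" "q \<le> real m + 1" "s \<ge> q + 1 / 2" for m
    using that
  proof (induction m arbitrary: s q)
    case 0
    then show ?case by (intro base) auto
  next
    case (Suc m)
    show ?case
    proof (cases "q \<le> 1")
      case True
      then show ?thesis using Suc.prems base by blast
    next
      case False
      have IH: "contour_integral \<gamma> (beta_kern (s - 1) (q - 1)) =
        2 * of_real pi * \<i> * of_real (Gamma (s - 1) / (Gamma (s - 1 - (q - 1) + 1) * Gamma (q - 1)))"
        by (rule Suc.IH) (use False Suc.prems in auto)
      have shift: "of_real (s - 1) * contour_integral \<gamma> (beta_kern (s - 1) (q - 1)) =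
          of_real (q - 1) * contour_integral \<gamma> (beta_kern s q)"
        using beta_kern_integral_shift_both[OF _ assms(3), of "s - 1" "q - 1"] False Suc.prems by simp
      have G1: "Gamma s = (s - 1) * Gamma (s - 1)"
        using False Suc.prems Gamma_plus1_pos[of "s - 1"] by auto
      have G2: "Gamma q = (q - 1) * Gamma (q - 1)"
        using False Suc.prems Gamma_plus1_pos[of "q - 1"] by auto
      have G: "(s - 1) * (Gamma (s - 1) / (Gamma (s - 1 - (q - 1) + 1) * Gamma (q - 1))) =
          (q - 1) * (Gamma s / (Gamma (s - q + 1) * Gamma q))"
        unfolding G1 G2 using False by simp
      have "of_real (q - 1) * contour_integral \<gamma> (beta_kern s q) = 2 * of_real pi * \<i> *
          of_real ((s - 1) * (Gamma (s - 1) / (Gamma (s - 1 - (q - 1) + 1) * Gamma (q - 1))))"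
        unfolding shift[symmetric] IH of_real_mult by (simp only: mult_ac)
      also have "\<dots> = of_real (q - 1) *
          (2 * of_real pi * \<i> * of_real (Gamma s / (Gamma (s - q + 1) * Gamma q)))"
        unfolding G of_real_mult by (simp only: mult_ac)
      finally have "of_real (q - 1) * contour_integral \<gamma> (beta_kern s q) = of_real (q - 1) *
          (2 * of_real pi * \<i> * of_real (Gamma s / (Gamma (s - q + 1) * Gamma q)))" .
      moreover have "complex_of_real (q - 1) \<noteq> 0" using False by simp
      ultimately show ?thesis by (metis mult_left_cancel)
    qed
  qed
  from this[OF assms(1) _ assms(2), of "nat \<lceil>q\<rceil>"]
  have "contour_integral \<gamma> (beta_kern s q) =
      2 * of_real pi * \<i> * of_real (Gamma s / (Gamma (s - q + 1) * Gamma q))"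
    by linarith
  moreover have "s \<ge> 1 / 2" using assms by auto
  ultimately show ?thesis using beta_kern_has_integral[OF _ assms(3)] by metis
qed

section \<open>Termwise integration on circles through the origin\<close>

text \<open>This bounds the distance from the origin along a circle from below; the reciprocal root
  of \<open>t * (1 - t)\<close> is the integrand of \<open>Beta (1/2) (1/2)\<close>. Concavity of
  the sine gives the first half of the interval, symmetry the second.\<close>

lemma sin_pi_ge:
  assumes "0 \<le> t" "t \<le> 1"
  shows "t * (1 - t) \<le> sin (pi * t)"
proof -
  have conv: "convex_on {0..pi/2} (\<lambda>x. - sin x)"
    by (rule f''_ge0_imp_convex[where f' = "\<lambda>x. - cos x" and f'' = sin])
      (auto intro!: derivative_eq_intros sin_ge_zero)
  have *: "u \<le> sin (pi * u)" if "0 \<le> u" "u \<le> 1 / 2" for u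
  proof -
    have "- sin ((1 - 2 * u) *\<^sub>R 0 + (2 * u) *\<^sub>R (pi / 2)) \<le> (1 - 2 * u) * - sin 0 + 2 * u * - sin (pi / 2)"
      using that by (intro convex_onD[OF conv]) auto
    then show ?thesis using that by (simp add: mult.commute)
  qed
  show ?thesis
  proof (cases "t \<le> 1 / 2")
    case True
    have "t * (1 - t) \<le> t" using assms by (simp add: mult_left_le)
    then show ?thesis using *[of t] True assms by linarith
  next
    case False
    have "t * (1 - t) \<le> 1 - t" using assms by (simp add: mult_left_le_one_le)
    also have "\<dots> \<le> sin (pi * (1 - t))" using *[of "1 - t"] False assms by simp
    also have "\<dots> = sin (pi * t)" by (simp add: right_diff_distrib sin_diff)
    finally show ?thesis .
  qed
qed

text \<open>The modulus is the length of a chord that subtends the central angle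
  \<open>2 pi t\<close> in a circle of diameter \<open>\<rho>\<close>.\<close>

lemma norm_slit_circle:
  assumes "\<rho> > 0" "0 \<le> t" "t \<le> 1"
  shows "norm (circlepath (of_real (\<rho> / 2)) (- \<rho> / 2) t) = \<rho> * sin (pi * t)"
proof -
  let ?z = "circlepath (complex_of_real (\<rho> / 2)) (- \<rho> / 2) t"
  have z: "?z = of_real (\<rho> / 2) * (1 - exp (\<i> * of_real (2 * (pi * t))))"
    by (simp add: circlepath algebra_simps)
  have "Re ?z = \<rho> * sin (pi * t) * sin (pi * t)"
    unfolding z by (simp add: Re_exp cos_double_sin power2_eq_square)
  moreover have "Im ?z = - \<rho> * sin (pi * t) * cos (pi * t)"
    unfolding z by (simp add: Im_exp sin_double)
  ultimately have "(Re ?z)\<^sup>2 + (Im ?z)\<^sup>2 = (\<rho> * sin (pi * t))\<^sup>2 * ((sin (pi * t))\<^sup>2 + (cos (pi * t))\<^sup>2)"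
    by algebra
  then have "norm ?z = \<bar>\<rho> * sin (pi * t)\<bar>" unfolding cmod_def by simp
  moreover have "sin (pi * t) \<ge> 0" using assms by (intro sin_ge_zero) auto
  ultimately show ?thesis using assms by simp
qed

text \<open>Dominated convergence: the circle stays within modulus \<open>\<rho>\<close>, so the
  partial sums are uniformly bounded, and \<open>g\<close> has at most an inverse square root
  singularity at the two ends, which is integrable.\<close>

lemma slit_circle_integral_power_series:
  assumes \<rho>: "\<rho> > 1" and sm: "summable (\<lambda>k. norm (c k) * \<rho> ^ k)"
    and \<gamma>: "\<gamma> = circlepath (of_real (\<rho> / 2)) (- \<rho> / 2)"
    and bnd: "\<And>t. 0 < t \<Longrightarrow> t < 1 \<Longrightarrow> norm (g (\<gamma> t)) * sqrt (norm (\<gamma> t)) \<le> C"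
    and int: "\<And>k. ((\<lambda>z. z ^ k * g z) has_contour_integral I k) \<gamma>"
  obtains J where "(\<lambda>k. c k * I k) sums J" "((\<lambda>z. (\<Sum>k. c k * z ^ k) * g z) has_contour_integral J) \<gamma>"
proof -
  define M where "M = (\<Sum>k. norm (c k) * \<rho> ^ k)"
  define v where "v = (\<lambda>t. vector_derivative \<gamma> (at t))"
  \<comment> \<open>The majorant: \<open>M\<close> bounds the partial sums,
    \<open>pi * \<rho>\<close> is the speed of the circle, and the remaining factors bound
    \<open>g\<close> because \<open>norm (\<gamma> t) \<ge> t * (1 - t)\<close>. The exponents are
    written in the shape of a Beta integrand.\<close>
  define h where "h = (\<lambda>t. M * \<bar>C\<bar> * (pi * \<rho>) * (t powr (1/2 - 1) * (1 - t) powr (1/2 - 1)))"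
  have nv: "norm (v t) = pi * \<rho>" for t
    using \<rho> by (simp add: v_def \<gamma> vector_derivative_circlepath norm_mult)
  have M0: "M \<ge> 0" unfolding M_def using \<rho> by (intro suminf_nonneg sm) auto
  have n\<gamma>: "norm (\<gamma> t) \<le> \<rho>" "norm (\<gamma> t) \<ge> t * (1 - t)" if "0 < t" "t < 1" for t
  proof -
    have *: "norm (\<gamma> t) = \<rho> * sin (pi * t)" unfolding \<gamma> by (rule norm_slit_circle) (use \<rho> that in auto)
    show "norm (\<gamma> t) \<le> \<rho>" unfolding * using \<rho> by (simp add: mult_left_le)
    have "1 * (t * (1 - t)) \<le> \<rho> * sin (pi * t)"
      using \<rho> that sin_pi_ge[of t] by (intro mult_mono) auto
    then show "norm (\<gamma> t) \<ge> t * (1 - t)" by (simp add: *)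
  qed
  have gb: "norm (g (\<gamma> t)) \<le> \<bar>C\<bar> * (t powr (1/2 - 1) * (1 - t) powr (1/2 - 1))" if t: "0 < t" "t < 1" for t
  proof -
    have p: "0 < t * (1 - t)" using t by simp
    have "norm (g (\<gamma> t)) * sqrt (t * (1 - t)) \<le> norm (g (\<gamma> t)) * sqrt (norm (\<gamma> t))"
      using n\<gamma>(2)[OF t] by (intro mult_left_mono) auto
    also have "\<dots> \<le> \<bar>C\<bar>" using bnd[OF t] by linarith
    finally have "norm (g (\<gamma> t)) \<le> \<bar>C\<bar> / sqrt (t * (1 - t))" using p by (simp add: pos_le_divide_eq)
    also have "\<dots> = \<bar>C\<bar> * (t * (1 - t)) powr (1/2 - 1)"
    proof -
      have "(t * (1 - t)) powr (1/2 - 1) = (t * (1 - t)) powr (- (1/2))" by simp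
      also have "\<dots> = inverse (sqrt (t * (1 - t)))" using p by (simp only: powr_minus powr_half_sqrt less_imp_le)
      finally show ?thesis by (simp only: divide_inverse)
    qed
    also have "(t * (1 - t)) powr (1/2 - 1) = t powr (1/2 - 1) * (1 - t) powr (1/2 - 1)"
      using t by (intro powr_mult)
    finally show ?thesis .
  qed
  define f where "f = (\<lambda>N t. \<Sum>k<N. c k * (\<gamma> t ^ k * g (\<gamma> t) * v t))"
  have intk: "((\<lambda>t. \<gamma> t ^ k * g (\<gamma> t) * v t) has_integral I k) {0..1}" for k
    using int[of k] by (simp add: has_contour_integral v_def)
  have intf: "(f N has_integral (\<Sum>k<N. c k * I k)) {0..1}" for N
    unfolding f_def by (intro has_integral_sum has_integral_mult_right intk) auto
  let ?F = "\<lambda>t. (\<Sum>k. c k * \<gamma> t ^ k) * g (\<gamma> t) * v t"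
  have fh: "norm (f N t) \<le> h t" and fl: "(\<lambda>N. f N t) \<longlonglongrightarrow> ?F t" if "t \<in> {0<..<1}" for N t
  proof -
    from that have t: "0 < t" "t < 1" by auto
    have ck: "norm (c k * \<gamma> t ^ k) \<le> norm (c k) * \<rho> ^ k" for k
      unfolding norm_mult norm_power using n\<gamma>(1)[OF t] by (intro mult_left_mono power_mono) auto
    have s: "summable (\<lambda>k. norm (c k * \<gamma> t ^ k))"
      by (rule summable_comparison_test[OF _ sm]) (use ck in auto)
    have f: "f N t = (\<Sum>k<N. c k * \<gamma> t ^ k) * (g (\<gamma> t) * v t)" for N
      by (simp add: f_def sum_distrib_right mult.assoc)
    have "norm (\<Sum>k<N. c k * \<gamma> t ^ k) \<le> (\<Sum>k<N. norm (c k) * \<rho> ^ k)"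
      using ck by (intro sum_norm_le) auto
    also have "\<dots> \<le> M" unfolding M_def using \<rho> by (intro sum_le_suminf sm) auto
    finally have "norm (f N t) \<le> M * ((\<bar>C\<bar> * (t powr (1/2 - 1) * (1 - t) powr (1/2 - 1))) * (pi * \<rho>))"
      unfolding f norm_mult nv using gb[OF t] M0 \<rho> by (intro mult_mono) auto
    then show "norm (f N t) \<le> h t" by (simp add: h_def mult_ac)
    have "(\<lambda>N. \<Sum>k<N. c k * \<gamma> t ^ k) \<longlonglongrightarrow> (\<Sum>k. c k * \<gamma> t ^ k)"
      by (rule summable_LIMSEQ[OF summable_norm_cancel[OF s]])
    then have "(\<lambda>N. f N t) \<longlonglongrightarrow> (\<Sum>k. c k * \<gamma> t ^ k) * (g (\<gamma> t) * v t)"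
      unfolding f by (intro tendsto_intros)
    then show "(\<lambda>N. f N t) \<longlonglongrightarrow> ?F t" by (simp add: mult_ac)
  qed
  have "h integrable_on {0..1}"
    unfolding h_def using has_integral_Beta_real[of "1/2" "1/2"]
    by (intro integrable_on_mult_right) (auto simp: integrable_on_def)
  then have hi: "h integrable_on {0<..<1}" by (simp add: integrable_on_open_interval_real)
  have fi: "f N integrable_on {0<..<1}" for N
    using has_integral_integrable[OF intf[of N]] by (simp add: integrable_on_open_interval_real)
  have "?F integrable_on {0<..<1}"
    by (rule dominated_convergence(1)[OF fi hi fh fl])
  then have Fi: "?F integrable_on {0..1}" by (simp add: integrable_on_open_interval_real)
  have "(\<lambda>N. integral {0<..<1} (f N)) \<longlonglongrightarrow> integral {0<..<1} ?F"
    by (rule dominated_convergence(2)[OF fi hi fh fl])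
  moreover have "integral {0<..<1} (f N) = (\<Sum>k<N. c k * I k)" for N
    using intf[of N] integral_open_interval_real[of 0 1 "f N"] by (simp add: integral_unique)
  ultimately have "(\<lambda>k. c k * I k) sums integral {0..1} ?F"
    using integral_open_interval_real[of 0 1 ?F] by (simp add: sums_def)
  moreover have "((\<lambda>z. (\<Sum>k. c k * z ^ k) * g z) has_contour_integral integral {0..1} ?F) \<gamma>"
    using Fi by (simp add: has_contour_integral v_def has_integral_integral)
  ultimately show ?thesis using that by blast
qed

section \<open>The incomplete beta function\<close>

text \<open>
  The series \<open>S\<close> solves \<open>(p - (p + q) z) S + z (1 - z) S' = 1 / B(p,q)\<close>, which says that
  \<open>z\<^sup>p (1 - z)\<^sup>q S(z)\<close> has the derivative \<open>z\<^bsup>p-1\<^esup> (1 - z)\<^bsup>q-1\<^esup> / B(p,q)\<close>.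
\<close>

lemma inc_beta_sums:
  fixes p q y :: real
  assumes p: "p > 0" and q: "q > 0" and y: "0 < y" "y < 1"
  shows "(\<lambda>k. Gamma (p + q + real k) / (Gamma (p + real k + 1) * Gamma q) * y ^ k) sums
    (inc_beta y p q / (y powr p * (1 - y) powr q))"
proof -
  define e where "e = (\<lambda>k. Gamma (p + q + real k) / (Gamma (p + real k + 1) * Gamma q))"
  have pos: "e k > 0" for k using p q by (simp add: e_def Gamma_real_pos)
  \<comment> \<open>This recurrence is the differential equation of the series, read off
    coefficientwise.\<close>
  have rec: "(p + real k + 1) * e (Suc k) = (p + q + real k) * e k" for k
  proof -
    have "Gamma (p + q + real k + 1) = (p + q + real k) * Gamma (p + q + real k)"
      "Gamma (p + real k + 1 + 1) = (p + real k + 1) * Gamma (p + real k + 1)"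
      using p q by (intro Gamma_plus1_pos; simp)+
    then show ?thesis using p by (simp add: e_def add_ac)
  qed
  have "p * e 0 = 1 / Beta p q"
  proof -
    have "Gamma (p + 1) = p * Gamma p" using p by (intro Gamma_plus1_pos) auto
    then show ?thesis using p by (simp add: e_def Beta_def)
  qed
  have sm: "summable (\<lambda>k. e k * z ^ k)" if z: "\<bar>z\<bar> < 1" for z
  proof (rule summable_in_conv_radius)
    have "(\<lambda>k. norm (e k) / norm (e (Suc k))) = (\<lambda>k. (p + real k + 1) / (p + q + real k))"
    proof
      fix k show "norm (e k) / norm (e (Suc k)) = (p + real k + 1) / (p + q + real k)"
        using rec[of k] pos[of k] pos[of "Suc k"] p q by (simp add: field_simps)
    qed
    also have "\<dots> \<longlonglongrightarrow> 1" by real_asymp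
    finally have "conv_radius e = 1"
      using pos by (intro conv_radius_ratio_limit_nonzero[of 1 1]) (auto simp: less_imp_neq[symmetric] one_ereal_def)
    then show "ereal (norm z) < conv_radius e" using that by simp
  qed
  define S where "S = (\<lambda>z. \<Sum>k. e k * z ^ k)"
  define S' where "S' = (\<lambda>z. \<Sum>k. diffs e k * z ^ k)"
  have dS: "(S has_field_derivative S' z) (at z)" if z: "\<bar>z\<bar> < 1" for z
  proof -
    obtain K where K: "\<bar>z\<bar> < K" "K < 1" using dense[OF z] by blast
    show ?thesis unfolding S_def S'_def by (rule termdiffs_strong[of e K]) (use K sm[of K] in auto)
  qed
  have ode: "(p - (p + q) * z) * S z + z * (1 - z) * S' z = p * e 0" if z: "\<bar>z\<bar> < 1" for z
  proof -
    have s1: "(\<lambda>k. e k * z ^ k) sums S z" using sm[OF z] by (simp add: S_def summable_sums)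
    have "summable (\<lambda>k. diffs e k * z ^ k)"
      by (rule termdiff_converges[of _ 1]) (use z sm in auto)
    have s3: "(\<lambda>k. real k * e k * z ^ k) sums (z * S' z)"
    proof -
      have "(\<lambda>k. z * (real k * e k * z ^ (k - Suc 0))) sums (z * S' z)"
        using diffs_equiv[OF \<open>summable (\<lambda>k. diffs e k * z ^ k)\<close>] by (auto intro!: sums_mult simp: S'_def)
      moreover have "z * (real k * e k * z ^ (k - Suc 0)) = real k * e k * z ^ k" for k
        by (cases k) auto
      ultimately show ?thesis by simp
    qed
    have "(\<lambda>k. p * (e k * z ^ k) + real k * e k * z ^ k) sums (p * S z + z * S' z)"
      by (intro sums_add sums_mult s1 s3)
    then have "(\<lambda>k. (p + real k) * e k * z ^ k) sums (p * S z + z * S' z)" by (simp add: algebra_simps)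
    \<comment> \<open>Dropping the term of index \<open>0\<close> aligns the two series for
      \<open>rec\<close>; that term is the constant \<open>p * e 0\<close> of the equation.\<close>
    then have a: "(\<lambda>k. (p + real (Suc k)) * e (Suc k) * z ^ Suc k) sums (p * S z + z * S' z - p * e 0)"
      by (subst sums_Suc_iff) simp
    have b: "(\<lambda>k. z * ((p + q) * (e k * z ^ k) + real k * e k * z ^ k)) sums (z * ((p + q) * S z + z * S' z))"
      by (intro sums_add sums_mult s1 s3)
    have eq: "(p + real (Suc k)) * e (Suc k) * z ^ Suc k = z * ((p + q) * (e k * z ^ k) + real k * e k * z ^ k)" for k
    proof -
      have "(p + real (Suc k)) * e (Suc k) * z ^ Suc k = ((p + real k + 1) * e (Suc k)) * z ^ Suc k" by (simp add: add_ac)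
      also have "\<dots> = z * ((p + q) * (e k * z ^ k) + real k * e k * z ^ k)" unfolding rec by (simp add: algebra_simps)
      finally show ?thesis .
    qed
    have "p * S z + z * S' z - p * e 0 = z * ((p + q) * S z + z * S' z)"
      by (rule sums_unique2[OF a[unfolded eq] b])
    then show ?thesis by (simp add: algebra_simps)
  qed
  define W where "W = (\<lambda>z. z powr p * (1 - z) powr q * S z)"
  have "((\<lambda>t. 1 / Beta p q * (t powr (p - 1) * (1 - t) powr (q - 1))) has_integral W y - W 0) {0..y}"
  proof (rule fundamental_theorem_of_calculus_interior_strong[of "{}"])
    have "continuous_on {0..y} S"
      using y by (intro continuous_at_imp_continuous_on ballI DERIV_isCont[OF dS]) auto
    then show "continuous_on {0..y} W"
      unfolding W_def using p q y by (intro continuous_intros continuous_on_powr') auto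
    fix t assume t: "t \<in> {0<..<y} - {}"
    have "(W has_field_derivative p * t powr (p - 1) * ((1 - t) powr q * S t) -
         t powr p * (q * (1 - t) powr (q - 1) * S t) + t powr p * (1 - t) powr q * S' t) (at t)"
      unfolding W_def using t y
      by (auto intro!: derivative_eq_intros dS simp: algebra_simps)
    also have "p * t powr (p - 1) * ((1 - t) powr q * S t) -
         t powr p * (q * (1 - t) powr (q - 1) * S t) + t powr p * (1 - t) powr q * S' t =
         t powr (p - 1) * (1 - t) powr (q - 1) * ((p - (p + q) * t) * S t + t * (1 - t) * S' t)"
    proof -
      have "t powr p = t powr (p - 1) * t" "(1 - t) powr q = (1 - t) powr (q - 1) * (1 - t)"
        using t y powr_add[of t "p - 1" 1] powr_add[of "1 - t" "q - 1" 1] by auto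
      then show ?thesis by algebra
    qed
    finally show "(W has_vector_derivative 1 / Beta p q * (t powr (p - 1) * (1 - t) powr (q - 1))) (at t)"
      using ode[of t] t y \<open>p * e 0 = 1 / Beta p q\<close>
      by (simp add: has_real_derivative_iff_has_vector_derivative mult_ac)
  qed (use y in auto)
  \<comment> \<open>\<open>W 0\<close> vanishes through the factor \<open>z powr p\<close>.\<close>
  from integral_unique[OF this] have "inc_beta y p q = W y"
    unfolding inc_beta_def integral_mult_right using p by (simp add: W_def)
  then have "inc_beta y p q / (y powr p * (1 - y) powr q) = S y"
    using y by (simp add: W_def)
  then show ?thesis using sm[of y] y by (simp add: e_def S_def summable_sums)
qed

section \<open>Loop integrals with the pole at \<open>1/y\<close>\<close>

lemma power_times_beta_kern:
  assumes "z \<in> slit_plane"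
  shows "z ^ k * beta_kern s q z = beta_kern (s + real k) q z"
proof -
  have "z powr of_real (s + real k - 1) = z powr (of_real (s - 1) + of_nat k)"
    by (rule arg_cong[of _ _ "(powr) z"]) simp
  also have "\<dots> = z powr of_real (s - 1) * z ^ k"
    using nonpos_Reals_slit_plane[OF assms] by (simp add: powr_add powr_nat)
  finally show ?thesis by (simp only: beta_kern_def mult_ac)
qed

text \<open>Subtracting \<open>N a\<close> in the numerator leaves a removable singularity, so the
  integral of the difference quotient is the same for all loops. The rest,
  \<open>N a / (z - a)\<close>, contributes a multiple of the winding number, which is zero for both
  loops.\<close>

lemma slit_loop_integral_pole_outside:
  assumes N: "N holomorphic_on slit_plane" and r: "r > 0"
    and bnd: "\<And>z. z \<in> slit_plane \<Longrightarrow> norm z < r \<Longrightarrow> norm (N z) * sqrt (norm z) \<le> C"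
    and a: "a \<in> slit_plane"
    and \<gamma>1: "slit_loop \<gamma>1" "a \<notin> path_image \<gamma>1" "winding_number \<gamma>1 a = 0"
    and \<gamma>2: "slit_loop \<gamma>2" "a \<notin> path_image \<gamma>2" "winding_number \<gamma>2 a = 0"
    and J: "((\<lambda>z. N z / (z - a)) has_contour_integral J) \<gamma>1"
  shows "((\<lambda>z. N z / (z - a)) has_contour_integral J) \<gamma>2"
proof -
  define g where "g = (\<lambda>z. if z = a then deriv N a else (N z - N a) / (z - a))"
  have g: "g holomorphic_on slit_plane"
    unfolding g_def by (rule pole_lemma[OF N]) (use a open_slit_plane in \<open>simp add: interior_open\<close>)
  have na: "norm a > 0" using nonpos_Reals_slit_plane[OF a] by simp
  \<comment> \<open>Below modulus \<open>r'\<close> the distance to \<open>a\<close> is at least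
    \<open>norm a / 2\<close>, and \<open>sqrt (norm z) \<le> 1\<close>.\<close>
  define r' where "r' = min 1 (min r (norm a / 2))"
  have "r' > 0" using r na by (simp add: r'_def)
  have gb: "norm (g z) * sqrt (norm z) \<le> (C + norm (N a)) / (norm a / 2)"
    if z: "z \<in> slit_plane" "norm z < r'" for z
  proof -
    have za: "norm a / 2 \<le> norm (z - a)"
      using z(2) norm_triangle_ineq2[of a z] by (simp add: r'_def norm_minus_commute)
    then have "z \<noteq> a" using na by auto
    have "norm (N z - N a) * sqrt (norm z) \<le> (norm (N z) + norm (N a)) * sqrt (norm z)"
      by (intro mult_right_mono norm_triangle_ineq4) auto
    also have "\<dots> = norm (N z) * sqrt (norm z) + norm (N a) * sqrt (norm z)" by (simp add: algebra_simps)
    also have "\<dots> \<le> C + norm (N a) * 1"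
      using z by (intro add_mono bnd mult_left_mono) (auto simp: r'_def)
    finally have b1: "norm (N z - N a) * sqrt (norm z) \<le> C + norm (N a)" by simp
    have eq: "norm (g z) * sqrt (norm z) = norm (N z - N a) * sqrt (norm z) / norm (z - a)"
      using \<open>z \<noteq> a\<close> by (simp add: g_def norm_divide)
    have b0: "0 \<le> norm (N z - N a) * sqrt (norm z)" by simp
    show ?thesis unfolding eq by (rule frac_le[OF order_trans[OF b0 b1] b1 _ za]) (use na in simp)
  qed
  obtain I where I: "\<And>\<gamma>. slit_loop \<gamma> \<Longrightarrow> (g has_contour_integral I) \<gamma>"
    using slit_loop_integral_unique[OF g \<open>r' > 0\<close> gb] by blast
  have NI: "((\<lambda>z. N z / (z - a)) has_contour_integral I) \<gamma>"
    if \<gamma>: "slit_loop \<gamma>" "a \<notin> path_image \<gamma>" "winding_number \<gamma> a = 0" for \<gamma>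
  proof -
    have "((\<lambda>z. 1 / (z - a)) has_contour_integral 0) \<gamma>"
      using has_contour_integral_winding_number[of \<gamma> a] \<gamma> by (simp add: slit_loop_def)
    from has_contour_integral_add[OF I[OF \<gamma>(1)] has_contour_integral_lmul[OF this, of "N a"]]
    have "((\<lambda>z. g z + N a * (1 / (z - a))) has_contour_integral I) \<gamma>" by simp
    then show ?thesis
    proof (rule has_contour_integral_eq)
      fix z assume "z \<in> path_image \<gamma>"
      then have "z \<noteq> a" using \<gamma> by auto
      then show "g z + N a * (1 / (z - a)) = N z / (z - a)" by (simp add: g_def flip: add_divide_distrib)
    qed
  qed
  show ?thesis using NI[OF \<gamma>2] has_contour_integral_unique[OF J NI[OF \<gamma>1]] by simp
qed

lemma slit_circle_winding:
  assumes "1 < \<rho>" "\<rho> < 1 / y"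
  shows "complex_of_real (1 / y) \<notin> path_image (circlepath (of_real (\<rho> / 2)) (- \<rho> / 2))"
    and "winding_number (circlepath (of_real (\<rho> / 2)) (- \<rho> / 2)) (complex_of_real (1 / y)) = 0"
proof -
  have "dist (complex_of_real (\<rho> / 2)) (of_real (1 / y)) = \<bar>\<rho> / 2 - 1 / y\<bar>"
    by (metis dist_of_real dist_real_def)
  then have out: "complex_of_real (1 / y) \<notin> cball (of_real (\<rho> / 2)) (\<rho> / 2)"
    using assms by simp
  have sub: "path_image (circlepath (complex_of_real (\<rho> / 2)) (- \<rho> / 2)) \<subseteq> cball (of_real (\<rho> / 2)) (\<rho> / 2)"
    using assms by auto
  show "complex_of_real (1 / y) \<notin> path_image (circlepath (of_real (\<rho> / 2)) (- \<rho> / 2))"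
    using out sub by blast
  show "winding_number (circlepath (of_real (\<rho> / 2)) (- \<rho> / 2)) (complex_of_real (1 / y)) = 0"
    by (rule winding_number_zero_outside[OF _ convex_cball _ out sub]) auto
qed

lemma beta_kern_slit_circle_bound:
  assumes "\<rho> > 1" "q > 0" "s \<ge> 1 / 2" "0 < t" "t < 1"
    and z: "z = circlepath (of_real (\<rho> / 2)) (- \<rho> / 2) t"
  shows "norm (beta_kern s q z) * sqrt (norm z) \<le> \<rho> powr (s - 1 / 2) * (\<rho> / 2 - \<bar>1 - \<rho> / 2\<bar>) powr (- q)"
    and "norm z \<le> \<rho>"
proof -
  have nz: "norm z = \<rho> * sin (pi * t)" unfolding z by (rule norm_slit_circle) (use assms in auto)
  then show "norm z \<le> \<rho>" using assms by (simp add: mult_left_le)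
  have "z \<noteq> 0" using slit_loop_circlepath[OF assms(1)] assms(4,5) nonpos_Reals_slit_plane unfolding z slit_loop_def by auto
  \<comment> \<open>This is the distance from \<open>1\<close>, which lies inside the disc, to the
    circle.\<close>
  have d: "\<rho> / 2 - \<bar>1 - \<rho> / 2\<bar> > 0" using assms(1) by (simp add: abs_if)
  have "norm (z - of_real (\<rho> / 2)) = \<rho> / 2"
    unfolding z circlepath using assms by (simp add: norm_mult)
  moreover have "norm (complex_of_real (1 - \<rho> / 2)) = \<bar>1 - \<rho> / 2\<bar>" by (rule norm_of_real)
  moreover have "z - 1 = (z - of_real (\<rho> / 2)) - of_real (1 - \<rho> / 2)" by simp
  ultimately have "\<rho> / 2 - \<bar>1 - \<rho> / 2\<bar> \<le> norm (z - 1)" by (metis norm_triangle_ineq2)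
  then have 1: "norm (z - 1) powr (- q) \<le> (\<rho> / 2 - \<bar>1 - \<rho> / 2\<bar>) powr (- q)"
    using d assms by (intro powr_mono2') auto
  have "norm z powr (s - 1) * sqrt (norm z) = norm z powr (s - 1 / 2)"
    using \<open>z \<noteq> 0\<close> by (simp flip: powr_half_sqrt powr_add)
  also have "\<dots> \<le> \<rho> powr (s - 1 / 2)" using \<open>norm z \<le> \<rho>\<close> assms by (intro powr_mono2) auto
  finally have "norm z powr (s - 1) * sqrt (norm z) * norm (z - 1) powr (- q) \<le>
      \<rho> powr (s - 1 / 2) * (\<rho> / 2 - \<bar>1 - \<rho> / 2\<bar>) powr (- q)"
    using 1 by (intro mult_mono) auto
  then show "norm (beta_kern s q z) * sqrt (norm z) \<le> \<rho> powr (s - 1 / 2) * (\<rho> / 2 - \<bar>1 - \<rho> / 2\<bar>) powr (- q)"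
    by (simp add: norm_beta_kern mult_ac)
qed

text \<open>Expand \<open>1 / (1 - y z)\<close> geometrically, which is possible on the whole circle
  as \<open>y * \<rho> < 1\<close>. The term of index \<open>k\<close> is Pochhammer's integral with
  \<open>s = p + q + k\<close>, whose values are the coefficients in \<open>inc_beta_sums\<close>;
  \<open>p \<ge> 1/2\<close> is its condition \<open>s \<ge> q + 1/2\<close> at
  \<open>k = 0\<close>.\<close>

lemma inc_beta_slit_circle:
  assumes q: "q > 0" and p: "p \<ge> 1 / 2" and y: "0 < y" "y < 1" and \<rho>: "1 < \<rho>" "\<rho> < 1 / y"
  shows "((\<lambda>z. beta_kern (p + q) q z / (1 - of_real y * z)) has_contour_integral
     2 * of_real pi * \<i> * of_real (inc_beta y p q / (y powr p * (1 - y) powr q)))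
     (circlepath (of_real (\<rho> / 2)) (- \<rho> / 2))"
proof -
  define \<gamma> where "\<gamma> = circlepath (complex_of_real (\<rho> / 2)) (- \<rho> / 2)"
  define e where "e = (\<lambda>k. 2 * of_real pi * \<i> * complex_of_real (Gamma (p + q + real k) / (Gamma (p + real k + 1) * Gamma q)))"
  have sl: "slit_loop \<gamma>" unfolding \<gamma>_def by (rule slit_loop_circlepath[OF \<rho>(1)])
  have y\<rho>: "y * \<rho> < 1" using y \<rho> by (simp add: field_simps)
  have sm: "summable (\<lambda>k. norm (complex_of_real y ^ k) * \<rho> ^ k)"
    using y\<rho> y \<rho> by (simp add: norm_power summable_geometric flip: power_mult_distrib)
  have int: "((\<lambda>z. z ^ k * beta_kern (p + q) q z) has_contour_integral e k) \<gamma>" for k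
  proof (rule has_contour_integral_cong_slit_loop[OF _ sl])
    have eq: "p + q + real k - q + 1 = p + real k + 1" by simp
    show "(beta_kern (p + q + real k) q has_contour_integral e k) \<gamma>"
      unfolding e_def using beta_kern_loop_integral[OF q _ sl, of "p + q + real k"] p by (simp only: eq)
  qed (rule power_times_beta_kern)
  have bnd: "norm (beta_kern (p + q) q (\<gamma> t)) * sqrt (norm (\<gamma> t)) \<le>
      \<rho> powr (p + q - 1 / 2) * (\<rho> / 2 - \<bar>1 - \<rho> / 2\<bar>) powr (- q)" if "0 < t" "t < 1" for t
    by (rule beta_kern_slit_circle_bound(1)[OF \<rho>(1) q _ that]) (use p q in \<open>simp_all add: \<gamma>_def\<close>)
  obtain J where J: "(\<lambda>k. of_real y ^ k * e k) sums J"
    "((\<lambda>z. (\<Sum>k. of_real y ^ k * z ^ k) * beta_kern (p + q) q z) has_contour_integral J) \<gamma>"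
    using slit_circle_integral_power_series[OF \<rho>(1) sm \<gamma>_def bnd int] by blast
  have "(\<lambda>k. 2 * of_real pi * \<i> * of_real (Gamma (p + q + real k) / (Gamma (p + real k + 1) * Gamma q) * y ^ k)) sums
     (2 * of_real pi * \<i> * of_real (inc_beta y p q / (y powr p * (1 - y) powr q)))"
    using p q y by (intro sums_mult sums_of_real inc_beta_sums) auto
  moreover have "2 * of_real pi * \<i> * of_real (Gamma (p + q + real k) / (Gamma (p + real k + 1) * Gamma q) * y ^ k) =
      of_real y ^ k * e k" for k
    by (simp add: e_def mult_ac)
  ultimately have "J = 2 * of_real pi * \<i> * of_real (inc_beta y p q / (y powr p * (1 - y) powr q))"
    using J(1) sums_unique2 by simp
  moreover have "((\<lambda>z. beta_kern (p + q) q z / (1 - of_real y * z)) has_contour_integral J) \<gamma>"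
    unfolding has_contour_integral
  proof (rule has_integral_spike_finite[of "{0, 1}"])
    show "((\<lambda>t. (\<Sum>k. of_real y ^ k * \<gamma> t ^ k) * beta_kern (p + q) q (\<gamma> t) * vector_derivative \<gamma> (at t)) has_integral J) {0..1}"
      using J(2) by (simp add: has_contour_integral)
    fix t :: real assume "t \<in> {0..1} - {0, 1}"
    then have "norm (\<gamma> t) \<le> \<rho>"
      unfolding \<gamma>_def by (intro beta_kern_slit_circle_bound(2)[OF \<rho>(1) q, of "p + q" t]) (use p q in auto)
    then have "norm (of_real y * \<gamma> t) < 1"
      using y y\<rho> by (simp add: norm_mult) (smt (verit) mult_left_mono)
    then have "(\<Sum>k. of_real y ^ k * \<gamma> t ^ k) = 1 / (1 - of_real y * \<gamma> t)"
      by (simp add: suminf_geometric flip: power_mult_distrib)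
    then show "beta_kern (p + q) q (\<gamma> t) / (1 - of_real y * \<gamma> t) * vector_derivative \<gamma> (at t) =
       (\<Sum>k. of_real y ^ k * \<gamma> t ^ k) * beta_kern (p + q) q (\<gamma> t) * vector_derivative \<gamma> (at t)" by simp
  qed simp
  ultimately show ?thesis by (simp add: \<gamma>_def)
qed

text \<open>The given loop may leave the disc in which the geometric expansion holds. The series is
  therefore integrated on a circle with \<open>1 < \<rho> < 1/y\<close>, and the integral of its sum
  is then carried over to \<open>\<gamma>\<close>.\<close>

lemma inc_beta_series_loop_integral:
  fixes c :: "nat \<Rightarrow> complex"
  assumes q: "q > 0" and p: "p \<ge> 1 / 2" and y: "0 < y" "y < 1" and \<gamma>: "loop_around_1 y \<gamma>"
    and c: "\<And>R. R > 0 \<Longrightarrow> summable (\<lambda>j. norm (c j) * R ^ j)"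
  obtains J where
    "(\<lambda>j. c j * (2 * of_real pi * \<i> * of_real (inc_beta y (p + real j) q / (y powr (p + real j) * (1 - y) powr q)))) sums J"
    "((\<lambda>z. (\<Sum>j. c j * z ^ j) * (beta_kern (p + q) q z / (1 - of_real y * z))) has_contour_integral J) \<gamma>"
proof -
  obtain \<rho> where \<rho>: "1 < \<rho>" "\<rho> < 1 / y" using y dense[of 1 "1 / y"] by auto
  define \<kappa> where "\<kappa> = circlepath (complex_of_real (\<rho> / 2)) (- \<rho> / 2)"
  define h where "h = (\<lambda>z. \<Sum>j. c j * z ^ j)"
  define a where "a = complex_of_real (1 / y)"
  have sl: "slit_loop \<kappa>" unfolding \<kappa>_def by (rule slit_loop_circlepath[OF \<rho>(1)])
  have sl\<gamma>: "slit_loop \<gamma>" "a \<notin> path_image \<gamma>" "winding_number \<gamma> a = 0"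
    using \<gamma> by (auto simp: loop_around_1_def slit_loop_def slit_plane_def a_def)
  have y\<rho>: "y * \<rho> < 1" using y \<rho> by (simp add: field_simps)
  have g_bnd: "norm (beta_kern (p + q) q (\<kappa> t) / (1 - of_real y * \<kappa> t)) * sqrt (norm (\<kappa> t)) \<le>
      \<rho> powr (p + q - 1 / 2) * (\<rho> / 2 - \<bar>1 - \<rho> / 2\<bar>) powr (- q) / (1 - y * \<rho>)" if t: "0 < t" "t < 1" for t
  proof -
    have b: "norm (beta_kern (p + q) q (\<kappa> t)) * sqrt (norm (\<kappa> t)) \<le>
        \<rho> powr (p + q - 1 / 2) * (\<rho> / 2 - \<bar>1 - \<rho> / 2\<bar>) powr (- q)" "norm (\<kappa> t) \<le> \<rho>"
      by (intro beta_kern_slit_circle_bound[OF \<rho>(1) q _ t]; use p q in \<open>simp add: \<kappa>_def\<close>)+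
    have "1 - y * \<rho> \<le> 1 - y * norm (\<kappa> t)" using b(2) y by (simp add: mult_left_mono)
    also have "\<dots> \<le> norm (1 - of_real y * \<kappa> t)"
      using norm_triangle_ineq2[of 1 "of_real y * \<kappa> t"] y by (simp add: norm_mult)
    finally have "1 - y * \<rho> \<le> norm (1 - of_real y * \<kappa> t)" .
    then show ?thesis
      using frac_le[OF _ b(1), of "1 - y * \<rho>"] y\<rho> by (simp add: norm_divide)
  qed
  have int: "((\<lambda>z. z ^ j * (beta_kern (p + q) q z / (1 - of_real y * z))) has_contour_integral
      2 * of_real pi * \<i> * of_real (inc_beta y (p + real j) q / (y powr (p + real j) * (1 - y) powr q))) \<kappa>" for j
  proof (rule has_contour_integral_cong_slit_loop[OF _ sl])
    show "((\<lambda>z. beta_kern (p + real j + q) q z / (1 - of_real y * z)) has_contour_integral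
      2 * of_real pi * \<i> * of_real (inc_beta y (p + real j) q / (y powr (p + real j) * (1 - y) powr q))) \<kappa>"
      unfolding \<kappa>_def by (rule inc_beta_slit_circle) (use q p y \<rho> in auto)
    show "z ^ j * (beta_kern (p + q) q z / (1 - of_real y * z)) = beta_kern (p + real j + q) q z / (1 - of_real y * z)"
      if "z \<in> slit_plane" for z
      using power_times_beta_kern[OF that, of j "p + q" q] by (simp add: add_ac)
  qed
  have "\<rho> > 0" using \<rho> by simp
  obtain J where J: "(\<lambda>j. c j * (2 * of_real pi * \<i> * of_real (inc_beta y (p + real j) q / (y powr (p + real j) * (1 - y) powr q)))) sums J"
    "((\<lambda>z. h z * (beta_kern (p + q) q z / (1 - of_real y * z))) has_contour_integral J) \<kappa>"
    using slit_circle_integral_power_series[OF \<rho>(1) c[OF \<open>\<rho> > 0\<close>] \<kappa>_def g_bnd int] unfolding h_def by blast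
  \<comment> \<open>Everything except the pole, by \<open>1 - y z = - y (z - a)\<close>.\<close>
  define N where "N = (\<lambda>z. - of_real (1 / y) * h z * beta_kern (p + q) q z)"
  have Neq: "h z * (beta_kern (p + q) q z / (1 - of_real y * z)) = N z / (z - a)" for z
  proof -
    have "1 - of_real y * z = - of_real y * (z - a)" using y by (simp add: a_def algebra_simps)
    then show ?thesis by (simp add: N_def)
  qed
  have smc: "summable (\<lambda>j. c j * z ^ j)" for z
  proof (rule summable_norm_cancel, rule summable_comparison_test[OF _ c[of "norm z + 1"]])
    show "\<exists>N. \<forall>n\<ge>N. norm (norm (c n * z ^ n)) \<le> norm (c n) * (norm z + 1) ^ n"
      by (auto simp: norm_mult norm_power intro!: mult_left_mono power_mono)
  qed (simp add: add_nonneg_pos)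
  have hol: "h holomorphic_on T" for T
  proof -
    have "(h has_field_derivative (\<Sum>j. diffs c j * z ^ j)) (at z)" for z
      unfolding h_def by (rule termdiffs_strong_converges_everywhere[OF smc])
    then show ?thesis by (meson field_differentiable_at_within field_differentiable_def holomorphic_on_def)
  qed
  have holN: "N holomorphic_on slit_plane" unfolding N_def by (intro holomorphic_intros hol)
  \<comment> \<open>The entire function \<open>h\<close> is bounded near the origin, so
    \<open>N\<close> obeys the same kind of bound there as \<open>beta_kern\<close>.\<close>
  have "compact (h ` cball 0 (1 / 2))"
    by (intro compact_continuous_image holomorphic_on_imp_continuous_on hol compact_cball)
  then obtain B where B: "\<And>z. norm z \<le> 1 / 2 \<Longrightarrow> norm (h z) \<le> B"
    by (meson bounded_iff compact_imp_bounded imageI mem_cball_0)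
  have Nb: "norm (N z) * sqrt (norm z) \<le> 1 / y * B * 2 powr \<bar>q\<bar>" if "norm z < 1 / 2" for z
  proof -
    have "norm (N z) * sqrt (norm z) = 1 / y * norm (h z) * (norm (beta_kern (p + q) q z) * sqrt (norm z))"
      using y by (simp add: N_def norm_mult norm_divide)
    also have "\<dots> \<le> 1 / y * B * 2 powr \<bar>q\<bar>"
      using B[of z] that beta_kern_bound[of "p + q" z q] p q y order_trans[OF norm_ge_zero B[of 0]]
      by (intro mult_mono) auto
    finally show ?thesis .
  qed
  have "a \<in> slit_plane" using y by (simp add: a_def slit_plane_iff)
  have "((\<lambda>z. N z / (z - a)) has_contour_integral J) \<gamma>"
    by (rule slit_loop_integral_pole_outside[OF holN _ Nb \<open>a \<in> slit_plane\<close> sl _ _ sl\<gamma> J(2)[unfolded Neq], of "1 / 2"])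
      (use slit_circle_winding[OF \<rho>] in \<open>simp_all only: \<kappa>_def a_def, simp_all\<close>)
  then show ?thesis using that J(1) by (simp add: h_def flip: Neq)
qed

section \<open>The complex error function\<close>

definition erf_coeff :: "nat \<Rightarrow> real" where
  "erf_coeff j = 1 / Gamma (real j + 3 / 2)"

lemma erf_coeff_pos: "erf_coeff j > 0"
  by (simp add: erf_coeff_def Gamma_real_pos)

lemma erf_coeff_Suc: "(real j + 3 / 2) * erf_coeff (Suc j) = erf_coeff j"
proof -
  have "Gamma (real j + 3 / 2 + 1) = (real j + 3 / 2) * Gamma (real j + 3 / 2)"
    by (rule Gamma_plus1_pos) auto
  then show ?thesis by (simp add: erf_coeff_def add_ac)
qed

lemma erf_coeff_0: "erf_coeff 0 = 2 / sqrt pi"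
proof -
  have "Gamma (1 / 2 + 1) = 1 / 2 * Gamma (1 / 2 :: real)" by (rule Gamma_plus1_pos) auto
  then have "Gamma (real 0 + 3 / 2) = sqrt pi / 2" by (simp add: Gamma_one_half_real)
  then show ?thesis by (simp only: erf_coeff_def) simp
qed

text \<open>In the recurrence \<open>j + 3/2\<close> exceeds \<open>j + 1\<close>, so the
  coefficients decay at least as fast as those of the exponential series, and the series converges
  everywhere.\<close>

lemma erf_coeff_le: "erf_coeff j \<le> erf_coeff 0 / fact j"
proof (induction j)
  case (Suc j)
  have "(real j + 1) * erf_coeff (Suc j) \<le> (real j + 3 / 2) * erf_coeff (Suc j)"
    using erf_coeff_pos[of "Suc j"] by (intro mult_right_mono) auto
  also have "\<dots> \<le> erf_coeff 0 / fact j" using Suc erf_coeff_Suc[of j] by simp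
  finally have "erf_coeff (Suc j) \<le> erf_coeff 0 / fact j / (real j + 1)"
    by (simp add: pos_le_divide_eq mult_ac)
  moreover have "erf_coeff 0 / fact j / (real j + 1) = erf_coeff 0 / fact (Suc j)"
    by (simp add: mult.commute add.commute)
  ultimately show ?case by (simp only:)
qed simp

lemma summable_erf_coeff: "summable (\<lambda>j. erf_coeff j * R ^ j)" if "R > 0"
proof (rule summable_comparison_test)
  show "\<exists>N. \<forall>n\<ge>N. norm (erf_coeff n * R ^ n) \<le> erf_coeff 0 * (R ^ n / fact n)"
    using erf_coeff_le erf_coeff_pos that
    by (auto simp: abs_mult less_imp_le intro!: exI[of _ 0] order_trans[OF mult_right_mono[OF erf_coeff_le]])
  show "summable (\<lambda>n. erf_coeff 0 * (R ^ n / fact n))"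
    using summable_exp[of R] by (intro summable_mult) (simp add: divide_inverse mult.commute)
qed

text \<open>The entire function \<open>exp w * erf (sqrt w) / sqrt w\<close>, a Mittag-Leffler
  function with parameters \<open>1\<close> and \<open>3/2\<close>. It is free of branches, unlike
  the root in the integrand.\<close>

definition erf_fun :: "complex \<Rightarrow> complex" where
  "erf_fun w = (\<Sum>j. of_real (erf_coeff j) * w ^ j)"

lemma summable_erf_fun: "summable (\<lambda>j. of_real (erf_coeff j) * w ^ j :: complex)"
proof (cases "w = 0")
  case False
  show ?thesis
    by (rule summable_norm_cancel)
      (use summable_erf_coeff[of "norm w"] False erf_coeff_pos in \<open>simp add: norm_mult norm_power less_imp_le\<close>)
qed simp

text \<open>The coefficient recurrence says that \<open>f = erf_fun\<close> solves
  \<open>f + 2 w f' - 2 w f = 2 / sqrt pi\<close>. At the square of \<open>z\<close>, the left side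
  is what the product rule leaves besides the Gaussian factor.\<close>

lemma has_field_derivative_exp_erf_fun:
  "((\<lambda>z. exp (- z\<^sup>2) * (z * erf_fun (z\<^sup>2))) has_field_derivative of_real (2 / sqrt pi) * exp (- z\<^sup>2)) (at z)"
proof -
  define c where "c = (\<lambda>j. complex_of_real (erf_coeff j))"
  define S' where "S' = (\<lambda>w. \<Sum>j. diffs c j * w ^ j)"
  have sm: "summable (\<lambda>j. c j * w ^ j)" for w unfolding c_def by (rule summable_erf_fun)
  have d: "(erf_fun has_field_derivative S' w) (at w)" for w
    using termdiffs_strong_converges_everywhere[OF sm, of w] by (simp add: erf_fun_def[abs_def] S'_def c_def)
  have ode: "erf_fun w + 2 * w * S' w - 2 * w * erf_fun w = of_real (2 / sqrt pi)" for w
  proof -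
    have s1: "(\<lambda>k. c k * w ^ k) sums erf_fun w"
      using summable_sums[OF sm[of w]] by (simp add: erf_fun_def c_def)
    have sd: "summable (\<lambda>k. diffs c k * w ^ k)"
      by (rule termdiff_converges_all[OF sm])
    have s3: "(\<lambda>k. of_nat k * c k * w ^ k) sums (w * S' w)"
    proof -
      have "(\<lambda>k. w * (of_nat k * c k * w ^ (k - Suc 0))) sums (w * S' w)"
        using diffs_equiv[OF sd] by (auto intro!: sums_mult simp: S'_def)
      moreover have "w * (of_nat k * c k * w ^ (k - Suc 0)) = of_nat k * c k * w ^ k" for k
        by (cases k) auto
      ultimately show ?thesis by simp
    qed
    have "(\<lambda>k. c k * w ^ k + 2 * (of_nat k * c k * w ^ k)) sums (erf_fun w + 2 * (w * S' w))"
      by (intro sums_add sums_mult s1 s3)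
    then have a: "(\<lambda>k. c (Suc k) * w ^ Suc k + 2 * (of_nat (Suc k) * c (Suc k) * w ^ Suc k)) sums
        (erf_fun w + 2 * (w * S' w) - c 0)"
      by (subst sums_Suc_iff) simp
    have b: "(\<lambda>k. 2 * w * (c k * w ^ k)) sums (2 * w * erf_fun w)"
      by (intro sums_mult s1)
    have eq: "c (Suc k) * w ^ Suc k + 2 * (of_nat (Suc k) * c (Suc k) * w ^ Suc k) = 2 * w * (c k * w ^ k)" for k
    proof -
      have "c k = of_real ((real k + 3 / 2) * erf_coeff (Suc k))" by (simp only: c_def erf_coeff_Suc)
      also have "\<dots> = (of_nat k + 3 / 2) * c (Suc k)" by (simp add: c_def)
      finally have ck: "c k = (of_nat k + 3 / 2) * c (Suc k)" .
      show ?thesis unfolding ck by (simp add: algebra_simps)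
    qed
    have "erf_fun w + 2 * (w * S' w) - c 0 = 2 * w * erf_fun w"
      by (rule sums_unique2[OF a[unfolded eq] b])
    then show ?thesis by (simp add: c_def erf_coeff_0 algebra_simps)
  qed
  have "((\<lambda>z. exp (- z\<^sup>2) * (z * erf_fun (z\<^sup>2))) has_field_derivative
      exp (- z\<^sup>2) * (erf_fun (z\<^sup>2) + 2 * z\<^sup>2 * S' (z\<^sup>2) - 2 * z\<^sup>2 * erf_fun (z\<^sup>2))) (at z)"
    by (auto intro!: derivative_eq_intros DERIV_chain2[OF d] simp: algebra_simps power2_eq_square)
  then show ?thesis unfolding ode by (simp only: mult.commute)
qed

section \<open>The error function as a Gaussian integral\<close>

lemma norm_exp_minus_square: "norm (exp (- z\<^sup>2)) = exp ((Im z)\<^sup>2 - (Re z)\<^sup>2)" for z :: complex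
  by (simp add: Re_power2)

lemma integral_erfc_tendsto:
  fixes z :: complex
  shows "(\<lambda>k. integral {0..real k} (\<lambda>s. exp (- ((z + of_real s)\<^sup>2)))) \<longlonglongrightarrow>
     integral {0..} (\<lambda>s. exp (- ((z + of_real s)\<^sup>2)))"
proof -
  let ?f = "\<lambda>s::real. exp (- ((z + of_real s)\<^sup>2))"
  let ?fk = "\<lambda>k s. if s \<in> {0..real k} then ?f s else 0"
  \<comment> \<open>The constant comes from the square of \<open>Re z + s - 1/2\<close> being
    nonnegative, which yields the exponential majorant \<open>C * exp (- s)\<close>.\<close>
  define C where "C = exp (1 / 4 + (Im z)\<^sup>2 - Re z)"
  have int: "?f integrable_on {0..real k}" for k
    by (intro integrable_continuous_real continuous_intros)
  have eq: "(?fk k has_integral integral {0..real k} ?f) {0..}" for k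
    by (subst has_integral_restrict) (use int in \<open>auto simp: has_integral_integral\<close>)
  have "(\<lambda>k. integral {0..} (?fk k)) \<longlonglongrightarrow> integral {0..} ?f"
  proof (rule dominated_convergence(2)[where h = "\<lambda>s. C * exp (- 1 * s)"])
    show "?fk k integrable_on {0..}" for k using eq by blast
    show "(\<lambda>s. C * exp (- 1 * s)) integrable_on {0..}"
      by (intro integrable_on_mult_right integrable_on_exp_minus_to_infinity) simp
    show "norm (?fk k s) \<le> C * exp (- 1 * s)" if "s \<in> {0..}" for k s
    proof -
      have "0 \<le> (Re z + s - 1 / 2)\<^sup>2" by simp
      then have "(Im z)\<^sup>2 - (Re z + s)\<^sup>2 \<le> (1 / 4 + (Im z)\<^sup>2 - Re z) + - 1 * s"
        by (simp add: power2_eq_square algebra_simps)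
      then have "norm (?f s) \<le> C * exp (- 1 * s)"
        unfolding norm_exp_minus_square C_def exp_add[symmetric] by simp
      moreover have "C * exp (- 1 * s) \<ge> 0" by (simp add: C_def)
      ultimately show ?thesis by auto
    qed
    show "(\<lambda>k. ?fk k s) \<longlonglongrightarrow> ?f s" if "s \<in> {0..}" for s
    proof (rule tendsto_eventually)
      show "\<forall>\<^sub>F k in sequentially. ?fk k s = ?f s"
        using eventually_ge_at_top[of "nat \<lceil>s\<rceil>"] by eventually_elim (use that in auto)
    qed
  qed
  then show ?thesis unfolding integral_unique[OF eq] .
qed

lemma integral_gaussian_complex:
  "integral {0..} (\<lambda>s. exp (- ((of_real s)\<^sup>2))) = complex_of_real (sqrt pi / 2)"
proof -
  have "((\<lambda>x::real. indicator {0..} x *\<^sub>R exp (- x\<^sup>2)) has_integral (sqrt pi / 2)) UNIV"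
    using has_integral_integral_lborel gaussian_moment_0 by (metis has_bochner_integral_iff)
  then have "((\<lambda>x::real. if x \<in> {0..} then exp (- x\<^sup>2) else 0) has_integral (sqrt pi / 2)) UNIV"
    by (rule has_integral_eq[rotated]) (simp add: indicator_def)
  then have "((\<lambda>x::real. exp (- x\<^sup>2)) has_integral (sqrt pi / 2)) {0..}"
    by (simp only: has_integral_restrict_UNIV)
  then have "((\<lambda>x::real. complex_of_real (exp (- x\<^sup>2))) has_integral of_real (sqrt pi / 2)) {0..}"
    by (rule has_integral_of_real)
  moreover have "complex_of_real (exp (- s\<^sup>2)) = exp (- ((of_real s)\<^sup>2))" for s
    by (simp flip: exp_of_real)
  ultimately show ?thesis by (simp add: integral_unique)
qed

text \<open>The right-hand side \<open>F\<close> is a primitive of the normalised Gaussian with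
  \<open>F 0 = 0\<close>, so \<open>erfc z\<close> is the limit of \<open>F (z + k) - F z\<close>.
  The real Gaussian integral gives the limit \<open>1\<close> of \<open>F k\<close>, and
  \<open>F (z + k)\<close> has the same limit because the Gaussian is tiny on the segment between
  the two points.\<close>

lemma erf_complex_eq: "erf z = exp (- z\<^sup>2) * (z * erf_fun (z\<^sup>2))" for z :: complex
proof -
  define F where "F = (\<lambda>z. exp (- z\<^sup>2) * (z * erf_fun (z\<^sup>2)))"
  define r where "r = norm z"
  have dF: "(F has_field_derivative of_real (2 / sqrt pi) * exp (- z\<^sup>2)) (at z)" for z
    unfolding F_def by (rule has_field_derivative_exp_erf_fun)
  have ftc: "of_real (2 / sqrt pi) * integral {0..real k} (\<lambda>s. exp (- ((z + of_real s)\<^sup>2))) = F (z + of_nat k) - F z" for k z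
  proof -
    have "((\<lambda>s. of_real (2 / sqrt pi) * exp (- ((z + of_real s)\<^sup>2))) has_integral F (z + of_real (real k)) - F (z + of_real 0)) {0..real k}"
    proof (rule fundamental_theorem_of_calculus)
      fix s :: real
      have "((\<lambda>w. F (z + w)) has_field_derivative of_real (2 / sqrt pi) * exp (- ((z + of_real s)\<^sup>2))) (at (of_real s))"
        unfolding add.commute[of z] by (rule DERIV_shift[THEN iffD1, OF dF])
      then show "((\<lambda>s. F (z + of_real s)) has_vector_derivative of_real (2 / sqrt pi) * exp (- ((z + of_real s)\<^sup>2))) (at s within {0..real k})"
        by (rule has_vector_derivative_real_field)
    qed simp
    from integral_unique[OF this] show ?thesis by (simp only: integral_mult_right) simp
  qed
  have lim: "(\<lambda>k. F (z + of_nat k) - F z) \<longlonglongrightarrow> erfc z" for z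
    using tendsto_mult_left[OF integral_erfc_tendsto[of z], of "of_real (2 / sqrt pi)"]
    unfolding ftc by (simp add: erfc_def)
  have "erfc (0::complex) = 1"
    unfolding erfc_def by (simp add: integral_gaussian_complex)
  with lim[of 0] have lim0: "(\<lambda>k. F (of_nat k)) \<longlonglongrightarrow> 1" by (simp add: F_def)
  \<comment> \<open>On the segment the imaginary part is at most \<open>r\<close> in modulus and the
    real part at least \<open>k - r\<close>; the exponent \<open>2 k r - k * k\<close> is
    \<open>r * r\<close> minus the square of \<open>k - r\<close>.\<close>
  have "(\<lambda>k. F (z + of_nat k) - F (of_nat k)) \<longlonglongrightarrow> 0"
  proof (rule Lim_null_comparison)
    have "norm (F (z + of_nat k) - F (of_nat k)) \<le> 2 / sqrt pi * exp (2 * real k * r - (real k)\<^sup>2) * r" if k: "real k \<ge> r" for k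
    proof -
      have "norm (F (z + of_nat k) - F (of_nat k)) \<le> 2 / sqrt pi * exp (2 * real k * r - (real k)\<^sup>2) * norm (z + of_nat k - of_nat k)"
      proof (rule field_differentiable_bound[where S = "closed_segment (of_nat k) (z + of_nat k)"])
        fix w assume "w \<in> closed_segment (of_nat k) (z + of_nat k)"
        then obtain u where u: "0 \<le> u" "u \<le> 1" "w = (1 - u) *\<^sub>R of_nat k + u *\<^sub>R (z + of_nat k)"
          by (auto simp: closed_segment_def)
        have w: "w = of_nat k + of_real u * z" by (simp add: u(3) scaleR_conv_of_real algebra_simps)
        have n: "norm (of_real u * z) \<le> r" using u by (simp add: norm_mult r_def mult_left_le_one_le)
        have "\<bar>Im w\<bar> \<le> r" "Re w \<ge> real k - r"
          using abs_Im_le_cmod[of "of_real u * z"] abs_Re_le_cmod[of "of_real u * z"] n by (auto simp: w)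
        then have "\<bar>Im w\<bar>\<^sup>2 \<le> r\<^sup>2" "(real k - r)\<^sup>2 \<le> (Re w)\<^sup>2"
          using k by (intro power_mono; simp)+
        then have "(Im w)\<^sup>2 - (Re w)\<^sup>2 \<le> 2 * real k * r - (real k)\<^sup>2"
          by (simp add: power2_eq_square algebra_simps)
        then show "norm (of_real (2 / sqrt pi) * exp (- w\<^sup>2)) \<le> 2 / sqrt pi * exp (2 * real k * r - (real k)\<^sup>2)"
          unfolding norm_mult norm_exp_minus_square norm_of_real by (intro mult_mono) auto
      qed (rule convex_closed_segment has_field_derivative_at_within[OF dF] ends_in_segment)+
      then show ?thesis by (simp add: r_def)
    qed
    then show "\<forall>\<^sub>F k in sequentially. norm (F (z + of_nat k) - F (of_nat k)) \<le> 2 / sqrt pi * exp (2 * real k * r - (real k)\<^sup>2) * r"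
      using eventually_ge_at_top[of "nat \<lceil>r\<rceil>"] by (auto elim!: eventually_mono)
    show "(\<lambda>k. 2 / sqrt pi * exp (2 * real k * r - (real k)\<^sup>2) * r) \<longlonglongrightarrow> 0"
      by real_asymp
  qed
  from tendsto_diff[OF tendsto_add[OF this lim0] tendsto_const[of "F z"]]
  have "(\<lambda>k. F (z + of_nat k) - F z) \<longlonglongrightarrow> 1 - F z" by simp
  with lim[of z] have "erfc z = 1 - F z" using LIMSEQ_unique by blast
  then show ?thesis by (simp add: erf_def F_def)
qed

section \<open>The integral representations\<close>

text \<open>Common form of both representations: \<open>p = 1/2\<close> serves \<open>P_nct\<close>
  and \<open>p = 1\<close> serves \<open>Q_nct\<close>. The surplus power
  \<open>y powr (p - 1/2)\<close> is moved under the integral so that the same factor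
  \<open>sqrt y\<close> stands in front.\<close>

lemma real_series_loop_integral:
  fixes d :: "nat \<Rightarrow> real"
  assumes q: "q > 0" and p: "p \<ge> 1 / 2" and y: "0 < y" "y < 1" and \<gamma>: "loop_around_1 y \<gamma>"
    and d: "\<And>R. R > 0 \<Longrightarrow> summable (\<lambda>j. \<bar>d j\<bar> * R ^ j)"
  obtains J where
    "((\<lambda>z. (\<Sum>j. of_real (d j) * (of_real y * z) ^ j) * (of_real (y powr (p - 1 / 2)) * beta_kern (p + q) q z / (1 - of_real y * z)))
        has_contour_integral J) \<gamma>"
    "of_real (\<Sum>j. d j * inc_beta y (p + real j) q) = of_real (sqrt y * (1 - y) powr q) / (2 * of_real pi * \<i>) * J"
proof -
  define c where "c = (\<lambda>j. complex_of_real (d j * y ^ j * y powr (p - 1 / 2)))"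
  have c: "summable (\<lambda>j. norm (c j) * R ^ j)" if "R > 0" for R
  proof -
    have "summable (\<lambda>j. y powr (p - 1 / 2) * (\<bar>d j\<bar> * (y * R) ^ j))"
      using that y by (intro summable_mult d) auto
    moreover have "norm (c j) * R ^ j = y powr (p - 1 / 2) * (\<bar>d j\<bar> * (y * R) ^ j)" for j
      unfolding c_def norm_of_real using y by (simp add: abs_mult power_mult_distrib)
    ultimately show ?thesis by simp
  qed
  obtain J where J:
    "(\<lambda>j. c j * (2 * of_real pi * \<i> * of_real (inc_beta y (p + real j) q / (y powr (p + real j) * (1 - y) powr q)))) sums J"
    "((\<lambda>z. (\<Sum>j. c j * z ^ j) * (beta_kern (p + q) q z / (1 - of_real y * z))) has_contour_integral J) \<gamma>"
    using inc_beta_series_loop_integral[OF q p y \<gamma> c] by blast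
  let ?A = "complex_of_real (sqrt y * (1 - y) powr q) / (2 * of_real pi * \<i>)"
  have eq: "?A * (c j * (2 * of_real pi * \<i> * of_real (inc_beta y (p + real j) q / (y powr (p + real j) * (1 - y) powr q)))) =
      of_real (d j * inc_beta y (p + real j) q)" for j
  proof -
    have "y powr (p + real j) = y powr (1 / 2 + (p - 1 / 2) + real j)" by simp
    also have "\<dots> = sqrt y * y powr (p - 1 / 2) * y ^ j"
      using y by (simp only: powr_add powr_half_sqrt powr_realpow less_imp_le)
    finally have yp: "y powr (p + real j) = sqrt y * y powr (p - 1 / 2) * y ^ j" .
    have "?A * (c j * (2 * of_real pi * \<i> * of_real (inc_beta y (p + real j) q / (y powr (p + real j) * (1 - y) powr q)))) =
      of_real ((sqrt y * (1 - y) powr q) * (d j * y ^ j * y powr (p - 1 / 2)) *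
        (inc_beta y (p + real j) q / (y powr (p + real j) * (1 - y) powr q)))"
    proof -
      have "of_real u / k * (of_real v * (k * of_real t)) = of_real (u * v * t)" if "k \<noteq> 0" for u v t and k :: complex
        using that by simp
      then show ?thesis unfolding c_def by this simp
    qed
    also have "(sqrt y * (1 - y) powr q) * (d j * y ^ j * y powr (p - 1 / 2)) *
        (inc_beta y (p + real j) q / (y powr (p + real j) * (1 - y) powr q)) = d j * inc_beta y (p + real j) q"
      unfolding yp using y by simp
    finally show ?thesis .
  qed
  have s: "(\<lambda>j. complex_of_real (d j * inc_beta y (p + real j) q)) sums (?A * J)"
    using sums_mult[OF J(1), of ?A] unfolding eq .
  \<comment> \<open>Real summability follows from the complex series, and it is what identifies the
    real infinite sum with the complex one.\<close>
  then have "summable (\<lambda>j. d j * inc_beta y (p + real j) q)"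
    using sums_summable summable_of_real_iff by blast
  then have val: "of_real (\<Sum>j. d j * inc_beta y (p + real j) q) = ?A * J"
    using s sums_unique2 sums_of_real[OF summable_sums] by blast
  have series: "(\<Sum>j. c j * z ^ j) * (beta_kern (p + q) q z / (1 - of_real y * z)) =
      (\<Sum>j. of_real (d j) * (of_real y * z) ^ j) * (of_real (y powr (p - 1 / 2)) * beta_kern (p + q) q z / (1 - of_real y * z))" for z
  proof -
    have "summable (\<lambda>j. of_real (d j) * (of_real y * z) ^ j)"
    proof (rule summable_norm_cancel, rule summable_comparison_test[OF _ d[of "norm z + 1"]])
      show "\<exists>N. \<forall>n\<ge>N. norm (norm (of_real (d n) * (of_real y * z) ^ n)) \<le> \<bar>d n\<bar> * (norm z + 1) ^ n"
      proof (intro exI allI impI)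
        fix n
        have "y * norm z \<le> norm z" using y by (intro mult_left_le_one_le) auto
        then show "norm (norm (of_real (d n) * (of_real y * z) ^ n)) \<le> \<bar>d n\<bar> * (norm z + 1) ^ n"
          using y by (auto simp: norm_mult norm_power intro!: mult_left_mono power_mono)
      qed
    qed (simp add: add_nonneg_pos)
    then have "(\<Sum>j. of_real (y powr (p - 1 / 2)) * (of_real (d j) * (of_real y * z) ^ j)) =
        of_real (y powr (p - 1 / 2)) * (\<Sum>j. of_real (d j) * (of_real y * z) ^ j)"
      by (rule suminf_mult)
    moreover have "of_real (y powr (p - 1 / 2)) * (of_real (d j) * (of_real y * z) ^ j) = c j * z ^ j" for j
      by (simp add: c_def power_mult_distrib mult_ac)
    ultimately show ?thesis by (simp add: mult_ac)
  qed
  show ?thesis by (rule that[OF J(2)[unfolded series] val])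
qed

text \<open>A positive factor leaves the argument unchanged, so the principal root splits.\<close>

lemma csqrt_of_real_mult:
  assumes "a > 0" "z \<noteq> 0"
  shows "csqrt (of_real a * z) = of_real (sqrt a) * csqrt z"
proof -
  have "csqrt (of_real a * z) = exp ((of_real (ln a) + Ln z) / 2)"
    using assms by (simp add: csqrt_exp_Ln Ln_times_of_real Ln_of_real)
  also have "\<dots> = exp (of_real (ln a / 2)) * exp (Ln z / 2)"
    by (simp add: add_divide_distrib exp_add)
  also have "exp (complex_of_real (ln a / 2)) = of_real (sqrt a)"
    unfolding exp_of_real using assms by (simp add: powr_def flip: powr_half_sqrt)
  finally show ?thesis using assms by (simp add: csqrt_exp_Ln)
qed

theorem theorem3p4:
  fixes n x \<delta> y :: real and \<gamma> :: "real \<Rightarrow> complex"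
  assumes "n > 0" and "x > 0" and "y = x\<^sup>2 / (n + x\<^sup>2)"
    and "loop_around_1 y \<gamma>"
  shows "kern n y \<delta> contour_integrable_on \<gamma> \<and>
         complex_of_real (P_nct n x \<delta>) =
           prefactor n y \<delta> * contour_integral \<gamma> (kern n y \<delta>) \<and>
         (\<lambda>\<tau>. kern n y \<delta> \<tau> * erf (of_real \<delta> * csqrt (of_real (y / 2) * \<tau>)))
           contour_integrable_on \<gamma> \<and>
         complex_of_real (Q_nct n x \<delta>) =
           prefactor n y \<delta> *
           contour_integral \<gamma> (\<lambda>\<tau>. kern n y \<delta> \<tau> * erf (of_real \<delta> * csqrt (of_real (y / 2) * \<tau>))) \<and>
         (\<lambda>\<tau>. kern n y \<delta> \<tau> * erfc (of_real \<delta> * csqrt (of_real (y / 2) * \<tau>)))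
           contour_integrable_on \<gamma> \<and>
         complex_of_real (R_nct n x \<delta>) =
           of_real (1 / 2 * erfc (\<delta> / sqrt 2)) -
           prefactor n y \<delta> *
           contour_integral \<gamma> (\<lambda>\<tau>. kern n y \<delta> \<tau> * erfc (of_real \<delta> * csqrt (of_real (y / 2) * \<tau>)))"
proof -
  define q where "q = n / 2"
  define E where "E = complex_of_real (1 / 2 * exp (- (\<delta>\<^sup>2 / 2)))"
  define A where "A = complex_of_real (sqrt y * (1 - y) powr q) / (2 * of_real pi * \<i>)"
  have pre: "prefactor n y \<delta> = E * A" by (simp add: prefactor_def E_def A_def q_def)
  have q: "q > 0" using assms by (simp add: q_def)
  have y: "0 < y" "y < 1" using assms by (auto simp: field_simps add_pos_pos)
  have sl: "slit_loop \<gamma>" using assms(4) by (auto simp: loop_around_1_def slit_loop_def slit_plane_def)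
  \<comment> \<open>The exponent \<open>n/2 - 1/2\<close> is \<open>s - 1\<close> for
    \<open>s = 1/2 + q\<close>, the case \<open>p = 1/2\<close>.\<close>
  have kern: "kern n y \<delta> z = exp (of_real (\<delta>\<^sup>2 / 2) * (of_real y * z)) * (beta_kern (1 / 2 + q) q z / (1 - of_real y * z))" for z
  proof -
    have "1 / 2 + q - 1 = n / 2 - 1 / 2" by (simp add: q_def)
    then show ?thesis
      by (simp only: kern_def beta_kern_def q_def of_real_minus powr_minus of_real_mult divide_inverse
          inverse_mult_distrib mult_ac)
  qed

  \<comment> \<open>The formula for \<open>P_nct\<close>, from the exponential series\<close>
  define d1 where "d1 = (\<lambda>j. (\<delta>\<^sup>2 / 2) ^ j / fact j)"
  have d1: "summable (\<lambda>j. \<bar>d1 j\<bar> * R ^ j)" if "R > 0" for R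
  proof -
    have "\<bar>d1 j\<bar> * R ^ j = inverse (fact j) * (\<delta>\<^sup>2 / 2 * R) ^ j" for j
    proof -
      have "\<bar>d1 j\<bar> = (\<delta>\<^sup>2 / 2) ^ j / fact j" unfolding d1_def by (intro abs_of_nonneg) auto
      then show ?thesis unfolding power_mult_distrib by (simp only: divide_inverse mult_ac)
    qed
    then show ?thesis using summable_exp[of "\<delta>\<^sup>2 / 2 * R"] by simp
  qed
  obtain J1 where J1:
    "((\<lambda>z. (\<Sum>j. of_real (d1 j) * (of_real y * z) ^ j) * (of_real (y powr (1 / 2 - 1 / 2)) * beta_kern (1 / 2 + q) q z / (1 - of_real y * z)))
        has_contour_integral J1) \<gamma>"
    "of_real (\<Sum>j. d1 j * inc_beta y (1 / 2 + real j) q) = A * J1"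
    using real_series_loop_integral[OF q _ y assms(4) d1, of "1 / 2"] unfolding A_def by auto
  have K1: "(kern n y \<delta> has_contour_integral J1) \<gamma>"
  proof (rule has_contour_integral_cong_slit_loop[OF J1(1) sl])
    fix z :: complex
    have "of_real (d1 j) * (of_real y * z) ^ j = (of_real (\<delta>\<^sup>2 / 2) * (of_real y * z)) ^ j /\<^sub>R fact j" for j
      by (simp only: d1_def scaleR_conv_of_real of_real_mult of_real_power power_mult_distrib divide_inverse mult_ac)
    then have "(\<Sum>j. of_real (d1 j) * (of_real y * z) ^ j) = exp (of_real (\<delta>\<^sup>2 / 2) * (of_real y * z))"
      by (simp only: exp_def)
    then show "kern n y \<delta> z = (\<Sum>j. of_real (d1 j) * (of_real y * z) ^ j) *
        (of_real (y powr (1 / 2 - 1 / 2)) * beta_kern (1 / 2 + q) q z / (1 - of_real y * z))"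
      using y by (simp add: kern)
  qed
  have P: "complex_of_real (P_nct n x \<delta>) = prefactor n y \<delta> * J1"
  proof -
    have "P_nct n x \<delta> = 1 / 2 * exp (- (\<delta>\<^sup>2 / 2)) * (\<Sum>j. d1 j * inc_beta y (1 / 2 + real j) q)"
      by (simp add: P_nct_def d1_def q_def assms(3) add.commute)
    then show ?thesis unfolding pre mult.assoc J1(2)[symmetric] E_def by (simp only: of_real_mult mult.assoc)
  qed

  \<comment> \<open>The formula for \<open>Q_nct\<close>, from the error function series\<close>
  define d2 where "d2 = (\<lambda>j. \<delta> / sqrt 2 * ((\<delta>\<^sup>2 / 2) ^ j / Gamma (real j + 3 / 2)))"
  have d2_eq: "d2 j = \<delta> / sqrt 2 * ((\<delta>\<^sup>2 / 2) ^ j * erf_coeff j)" for j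
    by (simp add: d2_def erf_coeff_def)
  have d2: "summable (\<lambda>j. \<bar>d2 j\<bar> * R ^ j)" if "R > 0" for R
  proof (cases "\<delta> = 0")
    case False
    then have "summable (\<lambda>j. \<bar>\<delta>\<bar> / sqrt 2 * (erf_coeff j * (\<delta>\<^sup>2 / 2 * R) ^ j))"
      using that by (intro summable_mult summable_erf_coeff) auto
    moreover have "\<bar>\<delta>\<bar> / sqrt 2 * (erf_coeff j * (\<delta>\<^sup>2 / 2 * R) ^ j) = \<bar>d2 j\<bar> * R ^ j" for j
      using erf_coeff_pos[of j] unfolding d2_eq power_mult_distrib abs_mult by (simp add: power_abs)
    ultimately show ?thesis by (simp only:)
  qed (simp add: d2_def)
  obtain J2 where J2:
    "((\<lambda>z. (\<Sum>j. of_real (d2 j) * (of_real y * z) ^ j) * (of_real (y powr (1 - 1 / 2)) * beta_kern (1 + q) q z / (1 - of_real y * z)))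
        has_contour_integral J2) \<gamma>"
    "of_real (\<Sum>j. d2 j * inc_beta y (1 + real j) q) = A * J2"
    using real_series_loop_integral[OF q _ y assms(4) d2, of 1] unfolding A_def by auto
  have K2: "((\<lambda>\<tau>. kern n y \<delta> \<tau> * erf (of_real \<delta> * csqrt (of_real (y / 2) * \<tau>))) has_contour_integral J2) \<gamma>"
  proof (rule has_contour_integral_cong_slit_loop[OF J2(1) sl])
    fix z assume "z \<in> slit_plane"
    note z = nonpos_Reals_slit_plane[OF this]
    define w where "w = of_real \<delta> * csqrt (of_real (y / 2) * z)"
    have w2: "w\<^sup>2 = of_real (\<delta>\<^sup>2 / 2) * (of_real y * z)"
      by (simp add: w_def power_mult_distrib)
    have w: "w = of_real (\<delta> / sqrt 2 * sqrt y) * csqrt z"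
      unfolding w_def using csqrt_of_real_mult[of "y / 2" z] y z by (simp add: real_sqrt_divide)
    have ser: "(\<Sum>j. of_real (d2 j) * (of_real y * z) ^ j) = of_real (\<delta> / sqrt 2) * erf_fun (w\<^sup>2)"
      unfolding erf_fun_def w2 suminf_mult[OF summable_erf_fun, symmetric]
      by (simp only: d2_eq power_mult_distrib of_real_mult of_real_power mult_ac)
    \<comment> \<open>Passing from \<open>p = 1/2\<close> to \<open>p = 1\<close> costs a factor
      \<open>csqrt z\<close>, which the odd factor \<open>w\<close> of the error function
      supplies.\<close>
    have bk: "beta_kern (1 + q) q z = csqrt z * beta_kern (1 / 2 + q) q z"
    proof -
      have "z powr of_real (1 + q - 1) = z powr (1 / 2 + of_real (1 / 2 + q - 1))"
        by (rule arg_cong[of _ _ "(powr) z"]) simp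
      also have "\<dots> = csqrt z * z powr of_real (1 / 2 + q - 1)"
        using z by (simp only: powr_add csqrt_conv_powr)
      finally show ?thesis by (simp only: beta_kern_def mult.assoc)
    qed
    \<comment> \<open>The exponential in \<open>kern\<close> is that of the square of
      \<open>w\<close> and cancels the Gaussian in \<open>erf_complex_eq\<close>.\<close>
    have "kern n y \<delta> z * erf w = exp (w\<^sup>2) * exp (- w\<^sup>2) * (w * erf_fun (w\<^sup>2)) * (beta_kern (1 / 2 + q) q z / (1 - of_real y * z))"
      unfolding kern erf_complex_eq w2[symmetric] by (simp only: mult_ac)
    also have "exp (w\<^sup>2) * exp (- w\<^sup>2) = 1" by (simp flip: exp_add)
    also have "1 * (w * erf_fun (w\<^sup>2)) * (beta_kern (1 / 2 + q) q z / (1 - of_real y * z)) =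
      (of_real (\<delta> / sqrt 2) * erf_fun (w\<^sup>2)) * (of_real (sqrt y) * (csqrt z * beta_kern (1 / 2 + q) q z) / (1 - of_real y * z))"
      by (subst (1) w) (simp add: mult_ac)
    also have "\<dots> = (\<Sum>j. of_real (d2 j) * (of_real y * z) ^ j) * (of_real (y powr (1 - 1 / 2)) * beta_kern (1 + q) q z / (1 - of_real y * z))"
      unfolding ser bk using y by (simp add: powr_half_sqrt)
    finally show "kern n y \<delta> z * erf (of_real \<delta> * csqrt (of_real (y / 2) * z)) =
      (\<Sum>j. of_real (d2 j) * (of_real y * z) ^ j) * (of_real (y powr (1 - 1 / 2)) * beta_kern (1 + q) q z / (1 - of_real y * z))"
      by (simp only: w_def)
  qed
  have Q: "complex_of_real (Q_nct n x \<delta>) = prefactor n y \<delta> * J2"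
  proof -
    have "Q_nct n x \<delta> = 1 / 2 * exp (- (\<delta>\<^sup>2 / 2)) * (\<Sum>j. d2 j * inc_beta y (1 + real j) q)"
      by (simp add: Q_nct_def d2_def q_def assms(3) add.commute)
    then show ?thesis unfolding pre mult.assoc J2(2)[symmetric] E_def by (simp only: of_real_mult mult.assoc)
  qed

  \<comment> \<open>The formula for \<open>R_nct\<close>, by linearity\<close>
  have K3: "((\<lambda>\<tau>. kern n y \<delta> \<tau> * erfc (of_real \<delta> * csqrt (of_real (y / 2) * \<tau>))) has_contour_integral (J1 - J2)) \<gamma>"
    using has_contour_integral_diff[OF K1 K2] by (simp add: erf_def algebra_simps)
  have R: "complex_of_real (R_nct n x \<delta>) =
      of_real (1 / 2 * erfc (\<delta> / sqrt 2)) - prefactor n y \<delta> * (J1 - J2)"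
    unfolding R_nct_def of_real_diff of_real_add P Q by (simp add: algebra_simps)
  show ?thesis
    unfolding contour_integral_unique[OF K1] contour_integral_unique[OF K2] contour_integral_unique[OF K3]
    using P Q R K1 K2 K3 contour_integrable_on_def by blast
qed

end
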